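(* There is an absolute constant $C>0$ such that the following holds. Fix $j\in\mathbb N$ and write $\phi=\phi_j$, $\lambda=\lambda_j$. For every $0<x\le 1$, $$\Big|\frac{\phi(x)}{x}-\tfrac12\lambda\phi(1)\widetilde B_2\!\left(\tfrac1x\right)\Big|\le C\,|\lambda|^5(\log|\lambda|)^2\,x\Big(1+\log\tfrac1x\Big).$$
   Context: Let $K:[0,1]\times[0,1]\to\mathbb R$ be defined by $K(x,y)=\frac12-\{(xy)^{-1}\}$ if $0<x,y\le 1$, and $K(x,y)=0$ if $0\le x,y\le1$ and $xy=0$, where $\{\alpha\}=\alpha-\lfloor\alpha\rfloor$. Let $L^2([0,1])$ denote the space of real-valued Lebesgue measurable square-integrable functions on $[0,1]$, with $\langle f,g\rangle=\int_0^1 f(x)g(x)\,dx$ and $\|f\|=\langle f,f\rangle^{1/2}$. A function $\phi$ is an eigenfunction of $K$ (with eigenvalue $\lambda\in\mathbb R$) if $\phi\in L^2([0,1])$, $\|\phi\|>0$, and $\phi(x)=\lambda\int_0^1 K(x,y)\phi(y)\,dy$ for every $x\in[0,1]$. Let $\phi_1,\phi_2,\ldots$ be a maximal orthonormal system in $L^2([0,1])$ of eigenfunctions of $K$, $\phi_j$ having the nonzero real eigenvalue $\lambda_j$, numbered so that $0<|\lambda_1|\le|\lambda_2|\le\cdots$ and $\lambda_j\ge\lambda_{j+1}$ whenever $|\lambda_j|=|\lambda_{j+1}|$. The periodic Bernoulli function is $\widetilde B_2(t)=\{t\}^2-\{t\}+\frac16$ for $t\in\mathbb R$. *)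

theory Defs
  imports "HOL-Analysis.Analysis"
begin

definition K :: "real \<Rightarrow> real \<Rightarrow> real" where
  "K x y = (if x * y = 0 then 0 else 1/2 - frac (1 / (x * y)))"

definition L2_01 :: "(real \<Rightarrow> real) \<Rightarrow> bool" where
  "L2_01 f \<longleftrightarrow> set_borel_measurable lebesgue {0..1} f
      \<and> set_integrable lebesgue {0..1} (\<lambda>x. (f x)^2)"

definition inner01 :: "(real \<Rightarrow> real) \<Rightarrow> (real \<Rightarrow> real) \<Rightarrow> real" where
  "inner01 f g = (LINT x:{0..1}|lebesgue. f x * g x)"

definition norm01 :: "(real \<Rightarrow> real) \<Rightarrow> real" where
  "norm01 f = sqrt (inner01 f f)"

definition eigenfunction :: "(real \<Rightarrow> real) \<Rightarrow> real \<Rightarrow> bool" where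
  "eigenfunction phi lam \<longleftrightarrow> L2_01 phi \<and> norm01 phi > 0 \<and>
     (\<forall>x\<in>{0..1}. phi x = lam * (LINT y:{0..1}|lebesgue. K x y * phi y))"

definition max_ortho_eigsys :: "(nat \<Rightarrow> real \<Rightarrow> real) \<Rightarrow> (nat \<Rightarrow> real) \<Rightarrow> bool" where
  "max_ortho_eigsys phi lam \<longleftrightarrow>
     (\<forall>j\<ge>1. eigenfunction (phi j) (lam j) \<and> lam j \<noteq> 0) \<and>
     (\<forall>i\<ge>1. \<forall>j\<ge>1. inner01 (phi i) (phi j) = (if i = j then 1 else 0)) \<and>
     \<not> (\<exists>psi mu. eigenfunction psi mu \<and> mu \<noteq> 0 \<and> (\<forall>j\<ge>1. inner01 psi (phi j) = 0)) \<and>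
     0 < \<bar>lam 1\<bar> \<and>
     (\<forall>j\<ge>1. \<bar>lam j\<bar> \<le> \<bar>lam (Suc j)\<bar>) \<and>
     (\<forall>j\<ge>1. \<bar>lam j\<bar> = \<bar>lam (Suc j)\<bar> \<longrightarrow> lam j \<ge> lam (Suc j))"

definition B2 :: "real \<Rightarrow> real" where
  "B2 t = (frac t)^2 - frac t + 1/6"

end

theory Submission
  imports Defs
begin

text \<open>
  Write \<open>g v = \<phi> (1 / v)\<close> for \<open>v \<ge> 1\<close>, \<open>R = |\<lambda>|\<close> and \<open>L = ln R\<close>; normalisation gives \<open>R \<ge> 2\<close> and
  \<open>|g| \<le> R / 2\<close>. The substitution \<open>y = 1 / w\<close> turns the eigenvalue equation into
  \<open>g v = \<lambda> \<integral>\<^sub>1\<^sup>\<infinity> (1/2 - {v w}) g w / w\<^sup>2 dw\<close>. Splitting \<open>{v w}\<close> as \<open>v w\<close> minus the number of \<open>n \<le> v w\<close> and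
  differentiating yields \<open>g' v = \<lambda> (\<Sum> n \<ge> v. g (n / v) / n - \<integral>\<^sub>1\<^sup>\<infinity> g w / w dw)\<close>, the error of a Riemann
  sum; truncating the integrals at a finite \<open>W\<close> avoids all convergence questions.

  The equation for \<open>g\<close> has an oscillating kernel, so regularity of \<open>g\<close> gives decay of \<open>g\<close>; the equation for \<open>g'\<close>
  turns decay into regularity. Alternating between them gives, up to constants,
  \<open>|g (v + h) - g v| \<le> R\<^sup>2 h\<^bsup>1/2\<^esup>\<close>, \<open>|g v| \<le> R\<^sup>3 v\<^bsup>-1/2\<^esup>\<close>, \<open>|g'| \<le> R\<^sup>2 L\<close>, \<open>|g v| \<le> R\<^sup>3 L / v\<close>,
  \<open>|g' v| \<le> R\<^sup>7 L v\<^bsup>-1/2\<^esup>\<close> and \<open>|g' v| \<le> R\<^sup>3 L\<^sup>2 / v\<close>. One integration by parts in the equation for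
  \<open>g (1 / x)\<close> produces the term with \<open>B2 (1 / x)\<close>; in the remainder the formula for \<open>g'\<close> is inserted and the
  \<open>n\<close>-th summand is again an oscillatory integral, bounded by \<open>x / n\<close>.
\<close>

subsection \<open>Periodic kernels and oscillatory integrals\<close>

text \<open>The formula \<open>P (t - k)\<close> is valid on the whole closed interval from
  \<open>k\<close> to \<open>k + 1\<close>, the right endpoint included because
  \<open>P 0 = P 1\<close>. Two neighbouring closed pieces are then glued to cover a neighbourhood
  of \<open>t\<close>.\<close>

lemma isCont_periodic_frac:
  fixes P :: "real \<Rightarrow> real"
  assumes cont: "continuous_on {0..1} P" and P01: "P 0 = P 1"
  shows "isCont (\<lambda>t. P (frac t)) t"
proof -
  have piece: "continuous_on {of_int k..of_int k + 1} (\<lambda>t. P (frac t))" for k :: int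
  proof -
    have "continuous_on {of_int k..of_int k + 1} (\<lambda>t. P (t - of_int k))"
      by (rule continuous_on_compose2[OF cont]) (auto intro!: continuous_intros)
    moreover have "P (frac t) = P (t - of_int k)" if "t \<in> {of_int k..of_int k + 1}" for t
    proof (cases "t = of_int k + 1")
      case True
      then have "t = of_int (k + 1)" by simp
      then have "frac t = 0" by (metis frac_of_int)
      with True P01 show ?thesis by simp
    next
      case False
      with that have "\<lfloor>t\<rfloor> = k" by (intro floor_unique) auto
      then show ?thesis by (simp add: frac_def)
    qed
    ultimately show ?thesis by (subst continuous_on_cong[OF refl]) auto
  qed
  define k where "k = \<lfloor>t\<rfloor>"
  have "continuous_on ({of_int (k - 1)..of_int (k - 1) + 1} \<union> {of_int k..of_int k + 1})
          (\<lambda>t. P (frac t))"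
    by (intro continuous_on_closed_Un piece) auto
  then have "continuous_on {of_int k - 1<..<of_int k + 1} (\<lambda>t. P (frac t))"
    by (rule continuous_on_subset) auto
  moreover have "t \<in> {of_int k - 1<..<of_int k + 1}"
    unfolding k_def by (auto simp: less_eq_real_def) linarith+
  ultimately show ?thesis
    by (simp add: continuous_on_eq_continuous_at)
qed

lemma has_real_derivative_frac:
  fixes t :: real
  assumes "t \<notin> \<int>"
  shows "(frac has_real_derivative 1) (at t)"
proof -
  define k where "k = \<lfloor>t\<rfloor>"
  have t: "t \<in> {of_int k<..<of_int k + 1}"
    using assms floor_correct[of t] unfolding k_def by (auto simp: less_le)
  have "((\<lambda>t. t - of_int k) has_real_derivative 1) (at t)"
    by (auto intro!: derivative_eq_intros)
  then show ?thesis
  proof (rule has_field_derivative_transform_within_open[OF _ _ t])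
    fix s :: real assume "s \<in> {of_int k<..<of_int k + 1}"
    then have "\<lfloor>s\<rfloor> = k" by (intro floor_unique) auto
    then show "s - of_int k = frac s" by (simp add: frac_def)
  qed auto
qed

text \<open>Provides the finite exceptional set for the fundamental theorem of calculus: the points
  where \<open>frac (u / x)\<close> jumps.\<close>

lemma finite_scaled_Ints:
  fixes a b x :: real
  assumes "x > 0"
  shows "finite {u \<in> {a..b}. u / x \<in> \<int>}"
proof (rule finite_subset)
  show "{u \<in> {a..b}. u / x \<in> \<int>} \<subseteq> (\<lambda>k. of_int k * x) ` {\<lfloor>a / x\<rfloor>..\<lceil>b / x\<rceil>}"
  proof
    fix u assume u: "u \<in> {u \<in> {a..b}. u / x \<in> \<int>}"
    then obtain k :: int where k: "u / x = of_int k" by (auto elim: Ints_cases)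
    have "a / x \<le> of_int k" "of_int k \<le> b / x"
      using u assms by (auto simp: k[symmetric] divide_right_mono)
    then have "k \<in> {\<lfloor>a / x\<rfloor>..\<lceil>b / x\<rceil>}" by (simp add: floor_le_iff le_ceiling_iff)
    moreover have "u = of_int k * x" using k assms by (simp add: field_simps)
    ultimately show "u \<in> (\<lambda>k. of_int k * x) ` {\<lfloor>a / x\<rfloor>..\<lceil>b / x\<rceil>}" by blast
  qed
qed auto

text \<open>The primitive \<open>x * P (frac (u / x))\<close> is continuous across the jumps because
  \<open>P 0 = P 1\<close>, and by periodicity it takes equal values at \<open>a\<close> and
  \<open>a + x\<close>.\<close>

lemma has_integral_periodic_primitive:
  fixes P P' :: "real \<Rightarrow> real"
  assumes der: "\<And>t. (P has_real_derivative P' t) (at t)" and P01: "P 0 = P 1"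
    and x: "x > 0"
  shows "((\<lambda>u. P' (frac (u / x))) has_integral 0) {a..a + x}"
proof -
  have cont: "isCont (\<lambda>t. P (frac t)) t" for t
    using der P01
    by (intro isCont_periodic_frac) (auto intro!: continuous_at_imp_continuous_on DERIV_isCont)
  have "((\<lambda>u. P' (frac (u / x))) has_integral
      (x * P (frac ((a + x) / x)) - x * P (frac (a / x)))) {a..a + x}"
  proof (rule fundamental_theorem_of_calculus_interior_strong[OF finite_scaled_Ints[OF x, of a "a + x"]])
    show "continuous_on {a..a + x} (\<lambda>u. x * P (frac (u / x)))"
    proof (intro continuous_at_imp_continuous_on ballI)
      fix u
      show "isCont (\<lambda>u. x * P (frac (u / x))) u"
        by (intro continuous_intros isCont_o2[OF _ cont]) (use x in auto)
    qed
  next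
    fix u assume u: "u \<in> {a<..<a + x} - {u \<in> {a..a + x}. u / x \<in> \<int>}"
    then have "u / x \<notin> \<int>" by auto
    then have "(frac has_real_derivative 1) (at (u / x))" by (rule has_real_derivative_frac)
    then have "((\<lambda>u. frac (u / x)) has_real_derivative 1 * (1 / x)) (at u)"
      by (rule DERIV_chain2) (use x in \<open>auto intro!: derivative_eq_intros\<close>)
    then have "((\<lambda>u. P (frac (u / x))) has_real_derivative P' (frac (u / x)) * (1 * (1 / x))) (at u)"
      by (rule DERIV_chain2[OF der])
    then have "((\<lambda>u. x * P (frac (u / x))) has_real_derivative x * (P' (frac (u / x)) * (1 * (1 / x)))) (at u)"
      by (rule DERIV_cmult)
    then show "((\<lambda>u. x * P (frac (u / x))) has_vector_derivative P' (frac (u / x))) (at u)"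
      using x by (simp add: has_real_derivative_iff_has_vector_derivative)
  qed (use x in auto)
  moreover have "(a + x) / x = a / x + 1" using x by (simp add: field_simps)
  ultimately show ?thesis by (simp add: frac_1_eq)
qed

section \<open>The sawtooth and the periodic Bernoulli function\<close>

definition saw :: "real \<Rightarrow> real" where
  "saw t = 1/2 - frac t"

lemma abs_saw_le: "\<bar>saw t\<bar> \<le> 1/2"
  using frac_ge_0[of t] frac_lt_1[of t] by (auto simp: saw_def abs_if)

lemma saw_measurable [measurable]: "saw \<in> borel_measurable borel"
  unfolding saw_def[abs_def] frac_def by measurable

lemma saw_mean_zero:
  assumes "x > 0" shows "((\<lambda>u. saw (u / x)) has_integral 0) {a..a + x}"
  unfolding saw_def
  by (rule has_integral_periodic_primitive[where P = "\<lambda>t. t / 2 - t\<^sup>2 / 2"])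
     (use assms in \<open>auto intro!: derivative_eq_intros\<close>)

lemma B2_altdef: "B2 t = (frac t - 1/2)\<^sup>2 - 1/12"
  by (simp add: B2_def power2_eq_square algebra_simps)

lemma isCont_B2: "isCont B2 t"
  unfolding B2_def[abs_def]
  by (rule isCont_periodic_frac[where P = "\<lambda>t. t\<^sup>2 - t + 1/6"]) (auto intro!: continuous_intros)

lemma B2_measurable [measurable]: "B2 \<in> borel_measurable borel"
  unfolding B2_def[abs_def] frac_def by measurable

text \<open>The completed square lies between 0 and 1/4, so \<open>B2\<close> lies between -1/12 and
  1/6.\<close>

lemma abs_B2_le: "\<bar>B2 t\<bar> \<le> 1/6"
proof -
  have "(frac t - 1/2)\<^sup>2 \<le> (1/2)\<^sup>2"
    using frac_ge_0[of t] frac_lt_1[of t] by (intro power2_le_iff_abs_le[THEN iffD2]) (auto simp: abs_if)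
  then have "(frac t - 1/2)\<^sup>2 \<le> 1/4" by (simp add: power_divide)
  moreover have "0 \<le> (frac t - 1/2)\<^sup>2" by simp
  ultimately show ?thesis
    unfolding B2_altdef by (intro abs_leI) linarith+
qed

lemma B2_mean_zero:
  assumes "x > 0" shows "((\<lambda>u. B2 (u / x)) has_integral 0) {a..a + x}"
  unfolding B2_def
  \<comment> \<open>The constant 1/6 in \<open>B2\<close> is what makes this primitive vanish at
    both 0 and 1.\<close>
  by (rule has_integral_periodic_primitive[where P = "\<lambda>t. t^3 / 3 - t\<^sup>2 / 2 + t / 6"])
     (use assms in \<open>auto intro!: derivative_eq_intros\<close>)

text \<open>Makes \<open>- (x / 2) * B2 (u / x)\<close> a primitive of \<open>saw (u / x)\<close>
  off the jumps; integrating by parts against it later produces the Bernoulli term.\<close>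

lemma DERIV_B2:
  assumes "t \<notin> \<int>" shows "(B2 has_real_derivative - 2 * saw t) (at t)"
  unfolding B2_def[abs_def] saw_def
  by (rule derivative_eq_intros has_real_derivative_frac[OF assms] refl | simp)+

section \<open>Integrals of a bounded oscillating kernel against a slowly varying function\<close>

lemma measurable_times_continuous_integrable:
  fixes f b :: "real \<Rightarrow> real"
  assumes b: "b \<in> borel_measurable borel" and bnd: "\<And>t. \<bar>b t\<bar> \<le> c"
    and f: "continuous_on {p..q} f"
  shows "(\<lambda>u. b u * f u) absolutely_integrable_on {p..q}"
proof (rule measurable_bounded_by_integrable_imp_absolutely_integrable)
  have "f \<in> borel_measurable (lebesgue_on {p..q})"
    using f by (intro continuous_imp_measurable_on_sets_lebesgue) auto
  moreover have "b \<in> borel_measurable (lebesgue_on {p..q})"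
    using b by (intro measurable_restrict_space1) (simp add: measurable_completion)
  ultimately show "(\<lambda>u. b u * f u) \<in> borel_measurable (lebesgue_on {p..q})"
    by (rule borel_measurable_times[rotated])
  show "(\<lambda>u. c * \<bar>f u\<bar>) integrable_on {p..q}"
    by (intro integrable_continuous_interval continuous_intros f)
  show "norm (b u * f u) \<le> c * \<bar>f u\<bar>" for u
    using bnd[of u] by (simp add: abs_mult mult_right_mono)
qed auto

lemma abs_integral_le_const:
  fixes f :: "real \<Rightarrow> real"
  assumes f: "f integrable_on {p..q}" and le: "p \<le> q" and bnd: "\<And>u. u \<in> {p..q} \<Longrightarrow> \<bar>f u\<bar> \<le> c"
  shows "\<bar>integral {p..q} f\<bar> \<le> c * (q - p)"
proof -
  have "0 \<le> c" using bnd[of p] le by auto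
  from has_integral_bound_real[OF this finite.emptyI integrable_integral[OF f]] show ?thesis
    using le bnd by auto
qed

text \<open>On each period the mean-zero kernel only sees the oscillation of \<open>f\<close>; the resulting errors
  are dominated by the telescoping differences \<open>1/s - 1/(s + x)\<close>.\<close>

lemma oscillatory_integral_bound:
  fixes f b :: "real \<Rightarrow> real"
  assumes b: "b \<in> borel_measurable borel" and b_le: "\<And>t. \<bar>b t\<bar> \<le> 1/2"
    and mean: "\<And>a. ((\<lambda>u. b (u / x)) has_integral 0) {a..a + x}"
    and x: "0 < x" "x \<le> 1" and p: "1 \<le> p" "p \<le> q" and f: "continuous_on {p..q} f"
    and D: "\<And>u. u \<in> {p..q} \<Longrightarrow> \<bar>f u\<bar> \<le> D"
    and E: "\<And>s t. p \<le> s \<Longrightarrow> s \<le> t \<Longrightarrow> t \<le> s + x \<Longrightarrow> t \<le> q \<Longrightarrow> \<bar>f t - f s\<bar> \<le> E / s\<^sup>2"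
  shows "\<bar>integral {p..q} (\<lambda>u. b (u / x) * f u)\<bar> \<le> D * x / 2 + E"
proof -
  have bx: "(\<lambda>u. b (u / x)) \<in> borel_measurable borel" using b by measurable
  have int: "(\<lambda>u. b (u / x) * f u) integrable_on {s..t}" if "p \<le> s" "t \<le> q" for s t
    using measurable_times_continuous_integrable[OF bx b_le continuous_on_subset[OF f], of s t] that
    by (auto intro: set_lebesgue_integral_eq_integral)
  have E0: "0 \<le> E" using E[of p p] x p by (auto simp: zero_le_divide_iff)
  have cell: "\<bar>integral {s..s + x} (\<lambda>u. b (u / x) * f u)\<bar> \<le> E * (1 / s - 1 / (s + x))"
    if s: "p \<le> s" "s + x \<le> q" for s
  proof -
    have bs: "(\<lambda>u. b (u / x) * f s) integrable_on {s..s + x}" "integral {s..s + x} (\<lambda>u. b (u / x) * f s) = 0"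
      using has_integral_mult_left[OF mean[of s], of "f s"] by (auto simp: has_integral_iff)
    have i: "(\<lambda>u. b (u / x) * f u) integrable_on {s..s + x}" using int s by simp
    \<comment> \<open>Since the kernel has mean zero on the period, subtracting the constant
      \<open>f s\<close> does not change the integral.\<close>
    have "integral {s..s + x} (\<lambda>u. b (u / x) * f u)
        = integral {s..s + x} (\<lambda>u. b (u / x) * f u - b (u / x) * f s)"
      using bs i by (simp add: integral_diff)
    also have "\<bar>\<dots>\<bar> \<le> (1/2 * (E / s\<^sup>2)) * (s + x - s)"
    proof (rule abs_integral_le_const)
      show "(\<lambda>u. b (u / x) * f u - b (u / x) * f s) integrable_on {s..s + x}"
        using bs i by (intro integrable_diff)
      fix u assume u: "u \<in> {s..s + x}"
      have "\<bar>b (u / x) * f u - b (u / x) * f s\<bar> = \<bar>b (u / x)\<bar> * \<bar>f u - f s\<bar>"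
        by (simp add: abs_mult[symmetric] algebra_simps)
      also have "\<dots> \<le> 1/2 * (E / s\<^sup>2)"
        using u s by (intro mult_mono b_le E) auto
      finally show "\<bar>b (u / x) * f u - b (u / x) * f s\<bar> \<le> 1/2 * (E / s\<^sup>2)" .
    qed (use x in auto)
    also have "\<dots> = E * (x / (2 * s\<^sup>2))" by simp
    also have "\<dots> \<le> E * (x / (s * (s + x)))"
    proof (intro mult_left_mono divide_left_mono E0)
      \<comment> \<open>Uses \<open>x \<le> 1 \<le> s\<close>; it trades
        \<open>x / (2 * s^2)\<close> for \<open>x / (s * (s + x))\<close>, which telescopes over
        consecutive periods.\<close>
      have "s * x \<le> s * s" using s p x by (intro mult_left_mono) auto
      then show "s * (s + x) \<le> 2 * s\<^sup>2" by (simp add: power2_eq_square algebra_simps)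
    qed (use s p x in auto)
    also have "x / (s * (s + x)) = 1 / s - 1 / (s + x)"
      using s p x by (simp add: field_simps)
    finally show ?thesis .
  qed
  have cells: "\<bar>integral {p..p + real n * x} (\<lambda>u. b (u / x) * f u)\<bar> \<le> E * (1 / p - 1 / (p + real n * x))"
    if "p + real n * x \<le> q" for n
    using that
  proof (induction n)
    case (Suc n)
    let ?s = "p + real n * x"
    have nx: "0 \<le> real n * x" using x by simp
    have eq: "p + real (Suc n) * x = ?s + x" by (simp add: algebra_simps)
    have le: "?s + x \<le> q" using Suc.prems eq by simp
    have "integral {p..?s + x} (\<lambda>u. b (u / x) * f u)
        = integral {p..?s} (\<lambda>u. b (u / x) * f u) + integral {?s..?s + x} (\<lambda>u. b (u / x) * f u)"
      using int[of p "?s + x"] le x nx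
      by (intro Henstock_Kurzweil_Integration.integral_combine[symmetric]) auto
    then show ?case
      using Suc.IH cell[of ?s] le x nx unfolding eq by (simp add: algebra_simps abs_le_iff)
  qed simp
  \<comment> \<open>The number of complete periods. The leftover interval is shorter than
    \<open>x\<close> and accounts for \<open>D * x / 2\<close>; the complete periods account for
    \<open>E\<close>.\<close>
  define n where "n = nat \<lfloor>(q - p) / x\<rfloor>"
  have "real n \<le> (q - p) / x" "(q - p) / x < real n + 1"
    unfolding n_def using p x by (auto simp: of_nat_nat)
  then have n: "p + real n * x \<le> q" "q < p + real n * x + x" "0 \<le> real n * x"
    using x by (auto simp: field_simps)
  have "integral {p..q} (\<lambda>u. b (u / x) * f u)
      = integral {p..p + real n * x} (\<lambda>u. b (u / x) * f u) + integral {p + real n * x..q} (\<lambda>u. b (u / x) * f u)"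
    using n int[of p q] by (intro Henstock_Kurzweil_Integration.integral_combine[symmetric]) auto
  moreover have "\<bar>integral {p..p + real n * x} (\<lambda>u. b (u / x) * f u)\<bar> \<le> E"
  proof (rule order.trans[OF cells[OF n(1)]])
    have "1 / p \<le> 1" "0 \<le> 1 / (p + real n * x)" using p n by auto
    then have "1 / p - 1 / (p + real n * x) \<le> 1" by linarith
    then show "E * (1 / p - 1 / (p + real n * x)) \<le> E" using E0 by (simp add: mult_left_le)
  qed
  moreover have "\<bar>integral {p + real n * x..q} (\<lambda>u. b (u / x) * f u)\<bar> \<le> D * x / 2"
  proof -
    have D0: "0 \<le> D" using D[of p] p by auto
    have "\<bar>integral {p + real n * x..q} (\<lambda>u. b (u / x) * f u)\<bar> \<le> 1/2 * D * (q - (p + real n * x))"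
      using n by (intro abs_integral_le_const int) (auto simp only: abs_mult atLeastAtMost_iff intro!: mult_mono b_le D)
    also have "\<dots> \<le> 1/2 * D * x" using n D0 by (intro mult_left_mono) auto
    finally show ?thesis by simp
  qed
  ultimately show ?thesis by linarith
qed

subsection \<open>Sums and Riemann sums\<close>

text \<open>Comparison with the logarithm, the first term costing at most 1. The range scales with
  \<open>u\<close>, so \<open>ln (u * V) - ln u\<close> leaves a bound free of
  \<open>u\<close>.\<close>

lemma sum_inverse_le_ln:
  fixes u V :: real
  assumes u: "1 \<le> u" and V: "1 \<le> V"
  shows "(\<Sum>n = nat \<lceil>u\<rceil>..nat \<lfloor>u * V\<rfloor>. 1 / real n) \<le> 1 + ln V"
proof -
  define a b where "a = nat \<lceil>u\<rceil>" and "b = nat \<lfloor>u * V\<rfloor>"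
  have a: "u \<le> real a" "1 \<le> a" unfolding a_def using u by linarith+
  have b: "real b \<le> u * V" unfolding b_def using u V by (simp add: of_nat_nat)
  show ?thesis
  proof (cases "a \<le> b")
    case False
    then show ?thesis using V by (simp add: a_def b_def)
  next
    case True
    have "(\<Sum>n = a..b. 1 / real n) \<le> 1 / real a + (ln (real b) - ln (real a))"
      using True
    proof (induction b rule: dec_induct)
      case (step m)
      have m: "real m > 0" using step a by simp
      have "ln (real m / real (Suc m)) \<le> real m / real (Suc m) - 1"
        using m by (intro ln_le_minus_one) auto
      also have "\<dots> = - 1 / real (Suc m)" using m by (simp add: field_simps)
      finally have "1 / real (Suc m) \<le> ln (real (Suc m)) - ln (real m)"
        using m by (simp add: ln_div)
      then show ?case using step by (simp add: sum.cl_ivl_Suc)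
    qed simp
    also have "\<dots> \<le> 1 + (ln (u * V) - ln u)"
      using a b u True by (intro add_mono diff_mono) (auto simp: ln_mono)
    also have "\<dots> = 1 + ln V" using u V by (simp add: ln_mult)
    finally show ?thesis by (simp add: a_def b_def)
  qed
qed

text \<open>Comparison with the integral, done by telescoping: \<open>1 + y \<le> exp y\<close>
  yields \<open>\<eta> * N powr (-1 - \<eta>) \<le> (N - 1) powr (-\<eta>) - N powr
  (-\<eta>)\<close>.\<close>

lemma sum_powr_le:
  fixes \<eta> :: real
  assumes eta: "0 < \<eta>" and a: "1 \<le> a"
  shows "(\<Sum>n = a..b. real n powr (-1 - \<eta>)) \<le> real a powr (-\<eta>) * (1 / real a + 1 / \<eta>)"
proof (cases "a \<le> b")
  case False
  then show ?thesis using eta by simp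
next
  case True
  have "(\<Sum>n = a..b. real n powr (-1 - \<eta>))
      \<le> real a powr (-1 - \<eta>) + (real a powr (-\<eta>) - real b powr (-\<eta>)) / \<eta>"
    using True
  proof (induction b rule: dec_induct)
    case (step m)
    have m: "real m > 0" using step a by simp
    define N where "N = real (Suc m)"
    have N: "N > 0" "real m = N - 1" by (auto simp: N_def)
    have "ln ((N - 1) / N) \<le> (N - 1) / N - 1" using m N by (intro ln_le_minus_one) auto
    also have "\<dots> = - 1 / N" using N by (simp add: field_simps)
    finally have "1 / N \<le> ln N - ln (N - 1)" using m N by (simp add: ln_div)
    then have "\<eta> * (1 / N) \<le> \<eta> * (ln N - ln (N - 1))" using eta by (intro mult_left_mono) auto
    then have "1 + \<eta> * (1 / N) \<le> exp (\<eta> * (ln N - ln (N - 1)))"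
      using exp_ge_add_one_self[of "\<eta> * (ln N - ln (N - 1))"] by linarith
    also have "\<dots> = (N - 1) powr (-\<eta>) / N powr (-\<eta>)"
      using m N by (simp add: powr_def exp_diff[symmetric] algebra_simps)
    finally have "(1 + \<eta> * (1 / N)) * N powr (-\<eta>) \<le> (N - 1) powr (-\<eta>)"
      using N by (simp add: field_simps)
    then have "\<eta> * (1 / N * N powr (-\<eta>)) \<le> (N - 1) powr (-\<eta>) - N powr (-\<eta>)"
      by (simp add: algebra_simps)
    moreover have "1 / N * N powr (-\<eta>) = N powr (-1 - \<eta>)"
      using N by (simp add: powr_diff powr_minus field_simps)
    ultimately have "\<eta> * N powr (-1 - \<eta>) \<le> (N - 1) powr (-\<eta>) - N powr (-\<eta>)" by metis
    then have "N powr (-1 - \<eta>) \<le> ((N - 1) powr (-\<eta>) - N powr (-\<eta>)) / \<eta>"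
      using eta by (simp add: pos_le_divide_eq mult.commute)
    then show ?case using step N by (simp add: sum.cl_ivl_Suc N_def[symmetric] diff_divide_distrib)
  qed simp
  also have "\<dots> \<le> real a powr (-1 - \<eta>) + real a powr (-\<eta>) / \<eta>"
    using eta by (intro add_left_mono divide_right_mono) auto
  also have "\<dots> = real a powr (-\<eta>) * (1 / real a + 1 / \<eta>)"
    using a by (simp add: powr_diff powr_minus field_simps)
  finally show ?thesis .
qed

text \<open>The factor \<open>u powr \<eta>\<close> from rescaling cancels against the first index
  raised to \<open>-\<eta>\<close>, so the bound is uniform in \<open>u\<close> and in the upper
  limit.\<close>

lemma sum_scaled_powr_le:
  fixes \<eta> u :: real
  assumes eta: "0 < \<eta>" and u: "1 \<le> u"
  shows "(\<Sum>n = nat \<lceil>u\<rceil>..b. (real n / u) powr (-\<eta>) / real n) \<le> 1 + 1 / \<eta>"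
proof -
  define a where "a = nat \<lceil>u\<rceil>"
  have a: "u \<le> real a" "1 \<le> a" unfolding a_def using u by linarith+
  have "(\<Sum>n = a..b. (real n / u) powr (-\<eta>) / real n) = (\<Sum>n = a..b. u powr \<eta> * real n powr (-1 - \<eta>))"
  proof (intro sum.cong refl)
    fix n assume "n \<in> {a..b}"
    then have "real n > 0" using a by auto
    then show "(real n / u) powr (-\<eta>) / real n = u powr \<eta> * real n powr (-1 - \<eta>)"
      using u by (simp add: powr_divide powr_diff powr_minus field_simps)
  qed
  also have "\<dots> \<le> u powr \<eta> * (real a powr (-\<eta>) * (1 / real a + 1 / \<eta>))"
    unfolding sum_distrib_left[symmetric] using sum_powr_le[OF eta a(2)] by (intro mult_left_mono) auto
  also have "\<dots> = (u powr \<eta> * real a powr (-\<eta>)) * (1 / real a + 1 / \<eta>)" by simp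
  also have "\<dots> \<le> 1 * (1 + 1 / \<eta>)"
  proof (intro mult_mono add_mono order_refl)
    have "u powr \<eta> \<le> real a powr \<eta>" using a u eta by (intro powr_mono2) auto
    then show "u powr \<eta> * real a powr (-\<eta>) \<le> 1" using a by (simp add: powr_minus field_simps)
  qed (use a eta in auto)
  finally show ?thesis by (simp add: a_def)
qed

lemma abs_integral_le_powr:
  fixes f :: "real \<Rightarrow> real"
  assumes f: "f integrable_on {p..q}" and p: "0 < p" "p \<le> q" and eta: "0 < \<eta>"
    and bnd: "\<And>w. w \<in> {p..q} \<Longrightarrow> \<bar>f w\<bar> \<le> c * w powr (-1 - \<eta>)"
  shows "\<bar>integral {p..q} f\<bar> \<le> c * p powr (-\<eta>) / \<eta>"
proof -
  have c: "0 \<le> c" using bnd[of p] p by (auto simp: zero_le_mult_iff dest: order_trans[OF abs_ge_zero])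
  have "((\<lambda>w. c * w powr (-1 - \<eta>)) has_integral (- c * q powr (-\<eta>) / \<eta> - - c * p powr (-\<eta>) / \<eta>)) {p..q}"
  proof (rule fundamental_theorem_of_calculus)
    fix w assume "w \<in> {p..q}"
    then have "w > 0" using p by auto
    then have "((\<lambda>w. - c * w powr (-\<eta>) / \<eta>) has_real_derivative c * w powr (-1 - \<eta>)) (at w within {p..q})"
      using eta by (auto intro!: derivative_eq_intros simp: diff_minus_eq_add minus_diff_commute)
    then show "((\<lambda>w. - c * w powr (-\<eta>) / \<eta>) has_vector_derivative c * w powr (-1 - \<eta>)) (at w within {p..q})"
      by (simp add: has_real_derivative_iff_has_vector_derivative)
  qed (use p in auto)
  then have "norm (integral {p..q} f) \<le> - c * q powr (-\<eta>) / \<eta> - - c * p powr (-\<eta>) / \<eta>"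
    using bnd f by (metis has_integral_iff Henstock_Kurzweil_Integration.integral_norm_bound_integral real_norm_def)
  moreover have "0 \<le> c * q powr (-\<eta>) / \<eta>" using c eta by auto
  ultimately show ?thesis by simp
qed

text \<open>The nodes \<open>n / u\<close> have mesh \<open>1 / u\<close>, and \<open>M\<close> is a
  Lipschitz constant anchored at the left end of each cell. The three copies of \<open>D / u\<close>
  pay for the incomplete first cell, the incomplete last cell, and the term at the last node, which
  has no complete cell to its right.\<close>

lemma riemann_sum_error:
  fixes h M :: "real \<Rightarrow> real"
  assumes u: "1 \<le> u" and V: "1 \<le> V" and h: "continuous_on {1..V} h"
    and D: "\<And>w. w \<in> {1..V} \<Longrightarrow> \<bar>h w\<bar> \<le> D"
    and M: "\<And>s t. 1 \<le> s \<Longrightarrow> s \<le> t \<Longrightarrow> t \<le> V \<Longrightarrow> \<bar>h t - h s\<bar> \<le> (t - s) * M s"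
    and M0: "\<And>s. 1 \<le> s \<Longrightarrow> 0 \<le> M s"
  shows "\<bar>(\<Sum>n = nat \<lceil>u\<rceil>..nat \<lfloor>u * V\<rfloor>. h (real n / u) / u) - integral {1..V} h\<bar>
      \<le> (3 * D + (\<Sum>n = nat \<lceil>u\<rceil>..nat \<lfloor>u * V\<rfloor>. M (real n / u) / u)) / u"
proof -
  define a b where "a = nat \<lceil>u\<rceil>" and "b = nat \<lfloor>u * V\<rfloor>"
  have a: "u \<le> real a" "real a < u + 1" unfolding a_def using u by linarith+
  have b: "real b \<le> u * V" "u * V < real b + 1"
    unfolding b_def using u V mult_mono[of 1 u 1 V] by (auto simp: of_nat_nat)
  have D0: "0 \<le> D" using D[of 1] V by auto
  have int: "h integrable_on {s..t}" if "1 \<le> s" "t \<le> V" for s t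
    using that by (intro integrable_continuous_interval continuous_on_subset[OF h]) auto
  have node: "1 \<le> real n / u" if "a \<le> n" for n
    using that a u by (auto simp: field_simps)
  show ?thesis
  proof (cases "a \<le> b")
    case False
    \<comment> \<open>Without a node the sum is empty and the interval has length at most
      \<open>1 / u\<close>.\<close>
    then have "u * V < u + 1" using a b by linarith
    then have "V - 1 \<le> 1 / u" using u by (simp add: field_simps)
    moreover have "\<bar>integral {1..V} h\<bar> \<le> D * (V - 1)"
      using V D by (intro abs_integral_le_const int) auto
    ultimately have "\<bar>integral {1..V} h\<bar> \<le> D * (1 / u)"
      using mult_left_mono[of "V - 1" "1 / u" D] D0 by linarith
    also have "\<dots> \<le> 3 * D / u" using D0 u by (simp add: field_simps)
    finally show ?thesis using False unfolding a_def[symmetric] b_def[symmetric] by simp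
  next
    case True
    have last: "real b / u \<le> V" using b u by (simp add: field_simps)
    have "\<bar>(\<Sum>n = a..<b. h (real n / u) / u) - integral {real a / u..real b / u} h\<bar>
        \<le> (\<Sum>n = a..<b. M (real n / u) / u / u) \<and> real b / u \<le> V"
      using True last
    proof (induction b rule: dec_induct)
      case (step m)
      have le: "real m / u \<le> real (Suc m) / u" using u by (simp add: field_simps)
      have m: "1 \<le> real m / u" using node step by auto
      have len: "real (Suc m) / u - real m / u = 1 / u" using u by (simp add: field_simps)
      have "integral {real a / u..real (Suc m) / u} h
          = integral {real a / u..real m / u} h + integral {real m / u..real (Suc m) / u} h"
        using le m step node[of a] u
        by (intro Henstock_Kurzweil_Integration.integral_combine[symmetric] int) (auto simp: divide_right_mono)
      moreover have "\<bar>h (real m / u) / u - integral {real m / u..real (Suc m) / u} h\<bar> \<le> M (real m / u) / u / u"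
      proof -
        have i: "h integrable_on {real m / u..real (Suc m) / u}" using m step by (intro int) auto
        have "h (real m / u) / u - integral {real m / u..real (Suc m) / u} h
            = - integral {real m / u..real (Suc m) / u} (\<lambda>w. h w - h (real m / u))"
          using i le by (subst integral_diff) (auto simp: add_divide_distrib algebra_simps)
        also have "\<bar>\<dots>\<bar> \<le> M (real m / u) / u * (real (Suc m) / u - real m / u)"
          unfolding abs_minus_cancel
        proof (rule abs_integral_le_const[OF _ le])
          show "(\<lambda>w. h w - h (real m / u)) integrable_on {real m / u..real (Suc m) / u}"
            by (intro integrable_diff i) auto
          fix w assume w: "w \<in> {real m / u..real (Suc m) / u}"
          have "\<bar>h w - h (real m / u)\<bar> \<le> (w - real m / u) * M (real m / u)"
            using w m step by (intro M) auto
          also have "\<dots> \<le> 1 / u * M (real m / u)"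
            using w len M0[OF m] by (intro mult_right_mono) auto
          finally show "\<bar>h w - h (real m / u)\<bar> \<le> M (real m / u) / u" by simp
        qed
        finally show ?thesis using len by simp
      qed
      ultimately show ?case using step le by (simp add: abs_le_iff)
    qed simp
    then have cells: "\<bar>(\<Sum>n = a..<b. h (real n / u) / u) - integral {real a / u..real b / u} h\<bar>
        \<le> (\<Sum>n = a..<b. M (real n / u) / u) / u" by (simp add: sum_divide_distrib)
    have ab: "1 \<le> real a / u" "real a / u \<le> real b / u" "1 \<le> real b / u"
      using node True u by (auto simp: divide_right_mono)
    have "integral {1..V} h = integral {1..real a / u} h + integral {real a / u..V} h"
      using ab last V by (intro Henstock_Kurzweil_Integration.integral_combine[symmetric] int) auto
    also have "integral {real a / u..V} h = integral {real a / u..real b / u} h + integral {real b / u..V} h"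
      using ab last V by (intro Henstock_Kurzweil_Integration.integral_combine[symmetric] int) auto
    finally have split: "integral {1..V} h = integral {1..real a / u} h
      + (integral {real a / u..real b / u} h + integral {real b / u..V} h)" .
    have "\<bar>integral {1..real a / u} h\<bar> \<le> D * (real a / u - 1)"
      using ab last D by (intro abs_integral_le_const int) auto
    also have "\<dots> \<le> D * (1 / u)"
      using a u D0 divide_right_mono[of "real a" "u + 1" u]
      by (intro mult_left_mono) (auto simp: add_divide_distrib)
    finally have e1: "\<bar>integral {1..real a / u} h\<bar> \<le> D / u" by simp
    have "\<bar>integral {real b / u..V} h\<bar> \<le> D * (V - real b / u)"
      using ab last D by (intro abs_integral_le_const int) auto
    also have "\<dots> \<le> D * (1 / u)"
      using b u D0 divide_right_mono[of "u * V" "real b + 1" u]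
      by (intro mult_left_mono) (auto simp: add_divide_distrib)
    finally have e2: "\<bar>integral {real b / u..V} h\<bar> \<le> D / u" by simp
    have e3: "\<bar>h (real b / u) / u\<bar> \<le> D / u" using D[of "real b / u"] ab last u by (auto simp: divide_right_mono)
    have e4: "0 \<le> M (real b / u) / u / u" using M0 ab u by auto
    have sums: "(\<Sum>n = a..b. h (real n / u) / u) = (\<Sum>n = a..<b. h (real n / u) / u) + h (real b / u) / u"
      "(\<Sum>n = a..b. M (real n / u) / u) / u = (\<Sum>n = a..<b. M (real n / u) / u) / u + M (real b / u) / u / u"
      using True by (auto simp: sum.last_plus add_divide_distrib)
    have "3 * D / u = D / u + D / u + D / u" by simp
    then show ?thesis
      unfolding a_def[symmetric] b_def[symmetric] add_divide_distrib sums split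
      using cells e1 e2 e3 e4 by linarith
  qed
qed

text \<open>Interpolating between a uniform bound and a decay rate \<open>v powr (-1/2)\<close> with the exponent
  \<open>\<eta> = 1 / (20 ln R)\<close> costs only a constant factor, since \<open>R powr (10 \<eta>) = exp (1/2)\<close>; summing
  \<open>v powr (-1 - \<eta>)\<close> then costs \<open>1 / \<eta>\<close>, a single logarithm.\<close>

lemma interpolated_decay:
  fixes R P y v :: real
  assumes R: "2 \<le> R" and v: "1 \<le> v" and P: "0 \<le> P"
    and y1: "y \<le> P" and y2: "y \<le> P * R ^ 5 * v powr (-1/2)"
  shows "y \<le> 2 * P * v powr (- (1 / (20 * ln R)))"
proof -
  define \<eta> where "\<eta> = 1 / (20 * ln R)"
  have L: "2/3 \<le> ln R" using ln2_ge_two_thirds ln_mono[of 2 R] R by linarith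
  have eta: "0 < \<eta>" "2 * \<eta> \<le> 1" using L by (auto simp: \<eta>_def field_simps)
  show ?thesis
  proof (cases "R ^ 5 * v powr (-1/2) \<le> 1")
    case True
    \<comment> \<open>For \<open>z \<le> 1\<close> the bound may be weakened to
      \<open>z powr (2 * \<eta>)\<close>; the exponent turns \<open>R ^ 5\<close> into
      \<open>exp (1/2)\<close> and \<open>v powr (-1/2)\<close> into
      \<open>v powr (-\<eta>)\<close>.\<close>
    define z where "z = R ^ 5 * v powr (-1/2)"
    have z: "0 < z" "z \<le> 1" using True R v by (auto simp: z_def)
    have "z \<le> z powr (2 * \<eta>)" using z eta powr_mono'[of "2 * \<eta>" 1 z] by simp
    also have "z powr (2 * \<eta>) = exp (1/2) * v powr (-\<eta>)"
    proof -
      have lnz: "ln z = 5 * ln R - ln v / 2" using R v by (simp add: z_def ln_mult ln_powr ln_realpow)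
      have "2 * \<eta> * ln z = 10 * \<eta> * ln R + -\<eta> * ln v" unfolding lnz by (simp add: algebra_simps)
      also have "10 * \<eta> * ln R = 1/2" using L by (simp add: \<eta>_def)
      finally have "2 * \<eta> * ln z = 1/2 + -\<eta> * ln v" .
      then show ?thesis using z v by (simp add: powr_def exp_add[symmetric])
    qed
    also have "\<dots> \<le> 2 * v powr (-\<eta>)"
    proof (intro mult_right_mono)
      have "exp (1/2 :: real) ^ 2 = exp 1" by (simp add: exp_double[symmetric])
      also have "\<dots> \<le> 2 ^ 2" using exp_le by simp
      finally show "exp (1/2 :: real) \<le> 2" by (rule power2_le_imp_le) simp
    qed simp
    finally have "P * z \<le> P * (2 * v powr (-\<eta>))" using P by (intro mult_left_mono)
    then show ?thesis using y2 by (simp add: z_def \<eta>_def mult.assoc)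
  next
    case False
    have v0: "v > 0" using v by simp
    \<comment> \<open>Here \<open>v\<close> is below \<open>R ^ 10\<close>, so
      \<open>v powr (-\<eta>)\<close> is at least \<open>exp (-1/2)\<close>, hence at least 1/2, and
      the uniform bound suffices.\<close>
    have "v powr (1/2) < R ^ 5" using False v0 by (simp add: powr_minus field_simps)
    then have "ln (v powr (1/2)) < ln (R ^ 5)" using v0 R by (subst ln_less_cancel_iff) auto
    then have "ln v < 10 * ln R" using v0 R by (simp add: ln_powr ln_realpow)
    then have "\<eta> * ln v \<le> 1/2" using L by (simp add: \<eta>_def field_simps)
    then have "exp (- (1/2)) \<le> exp (- \<eta> * ln v)" by simp
    moreover have "1/2 \<le> exp (- (1/2) :: real)" using exp_ge_add_one_self[of "- (1/2) :: real"] by simp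
    ultimately have "1/2 \<le> exp (- \<eta> * ln v)" by (rule order.trans[rotated])
    then have "1/2 \<le> v powr (-\<eta>)" using v0 by (simp add: powr_def)
    then have "P * (1/2) \<le> P * v powr (-\<eta>)" using P by (intro mult_left_mono)
    then show ?thesis using y1 by (simp add: \<eta>_def)
  qed
qed

subsection \<open>Truncated eigenfunctions and their derivatives\<close>

text \<open>Separates the jumps of the floor, so that each can be integrated and then differentiated
  in the parameter on its own.\<close>

lemma floor_eq_sum_indicator:
  fixes y :: real
  assumes "0 \<le> y" "y \<le> real N"
  shows "real_of_int \<lfloor>y\<rfloor> = (\<Sum>n = 1..N. if real n \<le> y then 1 else 0)"
proof -
  have "(\<Sum>n = 1..N. if real n \<le> y then 1 else 0 :: real) = real (card {n \<in> {1..N}. real n \<le> y})"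
    by (simp add: sum.If_cases Int_def)
  also have "{n \<in> {1..N}. real n \<le> y} = {1..nat \<lfloor>y\<rfloor>}"
    using assms by (auto simp: le_nat_iff le_floor_iff)
  also have "real (card {1..nat \<lfloor>y\<rfloor>}) = real_of_int \<lfloor>y\<rfloor>" using assms by simp
  finally show ?thesis by simp
qed

text \<open>Clamping the lower limit treats all positions of \<open>c\<close> at once: below 1 the
  full integral remains, above \<open>W\<close> the interval degenerates to a point.\<close>

lemma has_integral_cutoff:
  fixes f :: "real \<Rightarrow> real"
  assumes f: "continuous_on {1..W} f" and W: "1 \<le> W"
  shows "((\<lambda>w. if c \<le> w then f w else 0) has_integral integral {max 1 (min W c)..W} f) {1..W}"
proof (cases "c \<le> W")
  case True
  have "(f has_integral integral {max 1 c..W} f) {max 1 c..W}"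
    using True W by (intro integrable_integral integrable_continuous_interval continuous_on_subset[OF f]) auto
  then have "((\<lambda>w. if w \<in> {max 1 c..W} then f w else 0) has_integral integral {max 1 c..W} f) {1..W}"
    by (subst has_integral_restrict) auto
  then show ?thesis using True by (subst has_integral_cong[where g = "\<lambda>w. if w \<in> {max 1 c..W} then f w else 0"]) auto
next
  case False
  have "((\<lambda>w. if c \<le> w then f w else 0) has_integral 0) {1..W}"
    using False by (intro has_integral_is_0) auto
  then show ?thesis using False W by (simp add: min_def max_def)
qed

text \<open>The only limit \<open>W\<close> to infinity that is taken: it transfers bounds from
  truncations to \<open>g\<close>.\<close>

lemma le_of_le_plus_inverse:
  fixes a b c :: real
  assumes "\<And>W. W0 \<le> W \<Longrightarrow> a \<le> b + c / W"
  shows "a \<le> b"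
proof (rule tendsto_lowerbound[where F = at_top and f = "\<lambda>W. b + c / W"])
  have "((\<lambda>W. c / W) \<longlongrightarrow> 0) at_top"
    by (intro tendsto_divide_0[OF tendsto_const] filterlim_at_top_imp_at_infinity filterlim_ident)
  from tendsto_add[OF tendsto_const this] show "((\<lambda>W. b + c / W) \<longlongrightarrow> b) at_top" by simp
  show "\<forall>\<^sub>F W in at_top. a \<le> b + c / W"
    using eventually_ge_at_top[of W0] by (rule eventually_mono) (rule assms)
qed simp

text \<open>For an eigenfunction \<open>\<phi>\<close> with eigenvalue \<open>lam\<close>, the locale describes \<open>g v = \<phi> (1 / v)\<close>.\<close>

locale saw_eigenfunction =
  fixes g :: "real \<Rightarrow> real" and lam :: real
  assumes isCont_g: "isCont g v"
    and g_le: "\<bar>g v\<bar> \<le> \<bar>lam\<bar> / 2"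
    and lam_ge: "2 \<le> \<bar>lam\<bar>"
    and kernel_integrable: "1 \<le> v \<Longrightarrow> (\<lambda>w. saw (v * w) * (g w / w\<^sup>2)) absolutely_integrable_on {1..}"
    and g_eq: "1 \<le> v \<Longrightarrow> g v = lam * integral {1..} (\<lambda>w. saw (v * w) * (g w / w\<^sup>2))"
begin

section \<open>The truncated eigenvalue equation and its error\<close>

definition trunc :: "real \<Rightarrow> real \<Rightarrow> real" where
  "trunc W v = lam * integral {1..W} (\<lambda>w. saw (v * w) * (g w / w\<^sup>2))"

text \<open>The derivative of \<open>trunc W\<close> away from finitely many points of each bounded
  interval. With \<open>h w = g w / w\<close> the sum is the Riemann sum of \<open>h\<close> with
  nodes \<open>n / v\<close> and mesh \<open>1 / v\<close>, so the bracket is a quadrature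
  error.\<close>

definition dtrunc :: "real \<Rightarrow> real \<Rightarrow> real" where
  "dtrunc W v = lam * ((\<Sum>n = nat \<lceil>v\<rceil>..nat \<lfloor>v * W\<rfloor>. g (real n / v) / real n)
     - integral {1..W} (\<lambda>w. g w / w))"

lemma continuous_on_g [continuous_intros]:
  "continuous_on S f \<Longrightarrow> continuous_on S (\<lambda>x. g (f x))"
  using continuous_on_compose2[of UNIV g S f] isCont_g
  by (auto intro: continuous_at_imp_continuous_on)

lemma kernel_integrable_Icc:
  assumes "1 \<le> p"
  shows "(\<lambda>w. saw (v * w) * (g w / w\<^sup>2)) integrable_on {p..q}"
proof -
  have "(\<lambda>w. saw (v * w) * (g w / w\<^sup>2)) absolutely_integrable_on {p..q}"
    using assms
    by (intro measurable_times_continuous_integrable[where c = "1/2"] abs_saw_le)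
       (auto intro!: continuous_intros)
  then show ?thesis by (rule set_lebesgue_integral_eq_integral)
qed

text \<open>The tail is integrated with \<open>\<bar>saw\<bar> \<le> 1/2\<close> and the assumed
  decay. The exponent is a parameter because \<open>q = 0\<close> serves at the start, with only
  boundedness available, and \<open>q = 1\<close> after decay like \<open>1 / w\<close> is
  known.\<close>

lemma trunc_error:
  assumes W: "1 \<le> W" and v: "1 \<le> v" and q: "0 \<le> q"
    and D: "\<And>w. W \<le> w \<Longrightarrow> \<bar>g w\<bar> \<le> D * w powr (-q)"
  shows "\<bar>g v - trunc W v\<bar> \<le> \<bar>lam\<bar> * (D / 2 * W powr (-1 - q))"
proof -
  let ?f = "\<lambda>w. saw (v * w) * (g w / w\<^sup>2)"
  have D0: "0 \<le> D" using D[of W] W by (auto simp: zero_le_mult_iff dest: order_trans[OF abs_ge_zero])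
  have tail: "?f integrable_on {W..}"
    using set_integrable_subset[OF kernel_integrable[OF v], of "{W..}"] W
    by (auto intro: set_lebesgue_integral_eq_integral)
  have "(?f has_integral integral {1..W} ?f + integral {W..} ?f) ({1..W} \<union> {W..})"
    by (intro has_integral_Un integrable_integral kernel_integrable_Icc tail)
       (use W in \<open>auto intro: negligible_subset[of "{W}"]\<close>)
  moreover have "{1..W} \<union> {W..} = {1..}" using W by auto
  ultimately have "integral {1..} ?f = integral {1..W} ?f + integral {W..} ?f"
    by (auto simp: has_integral_iff)
  then have "g v - trunc W v = lam * integral {W..} ?f"
    using g_eq[OF v] by (simp add: trunc_def algebra_simps)
  moreover have "\<bar>integral {W..} ?f\<bar> \<le> D / 2 * W powr (-1 - q)"
  proof -
    have pw: "((\<lambda>w. D / 2 * w powr (-2 - q)) has_integral D / 2 * (- (W powr (-2 - q + 1)) / (-2 - q + 1))) {W..}"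
      using W q by (intro has_integral_mult_right has_integral_powr_to_inf) auto
    have "norm (integral {W..} ?f) \<le> integral {W..} (\<lambda>w. D / 2 * w powr (-2 - q))"
    proof (rule Henstock_Kurzweil_Integration.integral_norm_bound_integral[OF tail])
      show "(\<lambda>w. D / 2 * w powr (-2 - q)) integrable_on {W..}" using pw by blast
      fix w assume w: "w \<in> {W..}"
      then have "w > 0" using W by auto
      have "norm (?f w) = \<bar>saw (v * w)\<bar> * (\<bar>g w\<bar> / w\<^sup>2)" by (simp add: abs_mult)
      also have "\<dots> \<le> 1/2 * (D * w powr (-q) / w\<^sup>2)"
        using D[of w] w by (intro mult_mono abs_saw_le divide_right_mono) auto
      also have "\<dots> = D / 2 * w powr (-2 - q)"
        using \<open>w > 0\<close> by (simp add: powr_diff powr_minus powr_numeral field_simps)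
      finally show "norm (?f w) \<le> D / 2 * w powr (-2 - q)" .
    qed
    also have "\<dots> = D / 2 * (W powr (-1 - q) / (1 + q))"
      using integral_unique[OF pw] q by (simp add: field_simps)
    also have "\<dots> \<le> D / 2 * (W powr (-1 - q))"
      using D0 q by (intro mult_left_mono) (auto simp: field_simps)
    finally show ?thesis by simp
  qed
  ultimately show ?thesis by (simp only: abs_mult mult_left_mono abs_ge_zero)
qed

lemma trunc_error_crude:
  assumes "1 \<le> W" "1 \<le> v"
  shows "\<bar>g v - trunc W v\<bar> \<le> lam\<^sup>2 / 4 / W"
proof -
  have "\<bar>g v - trunc W v\<bar> \<le> \<bar>lam\<bar> * (\<bar>lam\<bar> / 2 / 2 * W powr (-1 - 0))"
    using assms g_le by (intro trunc_error) auto
  also have "\<dots> = lam\<^sup>2 / 4 / W"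
    using assms by (simp add: powr_minus_divide power2_eq_square flip: abs_mult)
  finally show ?thesis .
qed

text \<open>Writing \<open>saw (v * w)\<close> as \<open>1/2 - v * w\<close> plus a count of
  integers moves all dependence on \<open>v\<close> into a linear factor and into limits of
  integration. Any \<open>N\<close> above \<open>v * W\<close> is allowed, so one \<open>N\<close>
  works on a whole interval of \<open>v\<close>.\<close>

lemma trunc_expansion:
  assumes W: "1 \<le> W" and v: "1 \<le> v" and N: "v * W \<le> real N"
  shows "trunc W v = lam * (1/2 * integral {1..W} (\<lambda>w. g w / w\<^sup>2) - v * integral {1..W} (\<lambda>w. g w / w)
     + (\<Sum>n = 1..N. integral {max 1 (min W (real n / v))..W} (\<lambda>w. g w / w\<^sup>2)))"
proof -
  have c: "continuous_on {1..W} (\<lambda>w. g w / w\<^sup>2)" "continuous_on {1..W} (\<lambda>w. g w / w)"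
    by (auto intro!: continuous_intros)
  have "((\<lambda>w. 1/2 * (g w / w\<^sup>2) - v * (g w / w) + (\<Sum>n = 1..N. if real n / v \<le> w then g w / w\<^sup>2 else 0))
    has_integral (1/2 * integral {1..W} (\<lambda>w. g w / w\<^sup>2) - v * integral {1..W} (\<lambda>w. g w / w)
     + (\<Sum>n = 1..N. integral {max 1 (min W (real n / v))..W} (\<lambda>w. g w / w\<^sup>2)))) {1..W}"
    by (intro has_integral_add has_integral_diff has_integral_mult_right integrable_integral
        integrable_continuous_interval has_integral_sum has_integral_cutoff c W) auto
  moreover have "1/2 * (g w / w\<^sup>2) - v * (g w / w) + (\<Sum>n = 1..N. if real n / v \<le> w then g w / w\<^sup>2 else 0)
      = saw (v * w) * (g w / w\<^sup>2)" if w: "w \<in> {1..W}" for w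
  proof -
    have "v * w \<le> v * W" using w v by (intro mult_left_mono) auto
    then have "real_of_int \<lfloor>v * w\<rfloor> = (\<Sum>n = 1..N. if real n \<le> v * w then 1 else 0)"
      using w v N by (intro floor_eq_sum_indicator order.trans[OF _ N]) auto
    moreover have "(\<Sum>n = 1..N. if real n / v \<le> w then g w / w\<^sup>2 else 0)
        = (\<Sum>n = 1..N. if real n \<le> v * w then 1 else 0) * (g w / w\<^sup>2)"
      unfolding sum_distrib_right using v by (intro sum.cong) (auto simp: field_simps)
    ultimately have "(\<Sum>n = 1..N. if real n / v \<le> w then g w / w\<^sup>2 else 0)
        = real_of_int \<lfloor>v * w\<rfloor> * (g w / w\<^sup>2)" by simp
    moreover have "v * (g w / w) = (v * w) * (g w / w\<^sup>2)" using w by (simp add: power2_eq_square)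
    ultimately show ?thesis by (simp add: saw_def frac_def algebra_simps)
  qed
  ultimately have "((\<lambda>w. saw (v * w) * (g w / w\<^sup>2)) has_integral
     (1/2 * integral {1..W} (\<lambda>w. g w / w\<^sup>2) - v * integral {1..W} (\<lambda>w. g w / w)
     + (\<Sum>n = 1..N. integral {max 1 (min W (real n / v))..W} (\<lambda>w. g w / w\<^sup>2)))) {1..W}"
    by (rule has_integral_eq[rotated])
  then show ?thesis by (simp add: trunc_def integral_unique)
qed

section \<open>Differentiating the truncation in v\<close>

lemma continuous_on_tail_integral:
  "continuous_on {1..W} (\<lambda>t. integral {t..W} (\<lambda>w. g w / w\<^sup>2))"
  by (intro indefinite_integral_continuous_1' integrable_continuous_interval)
     (auto intro!: continuous_intros)

lemma DERIV_tail_integral: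
  assumes t: "1 < t" "t < W"
  shows "((\<lambda>t. integral {t..W} (\<lambda>w. g w / w\<^sup>2)) has_real_derivative - (g t / t\<^sup>2)) (at t)"
proof -
  let ?f = "\<lambda>w. g w / w\<^sup>2"
  have c: "continuous_on {1..W} ?f" by (auto intro!: continuous_intros)
  have "((\<lambda>t. integral {t..W} ?f) has_vector_derivative - ?f t) (at t within {1..W})"
    using t by (intro integral_has_vector_derivative' c) auto
  then show ?thesis
    using t at_within_interior[of t "{1..W}"]
    by (simp add: has_real_derivative_iff_has_vector_derivative)
qed

text \<open>The clamp is locally constant when \<open>n / v\<close> lies outside the interval from 1
  to \<open>W\<close>. Strictly inside, the chain rule gives
  \<open>g (n / v) / (n / v)^2 * (n / v^2)\<close>. The two excluded values of \<open>v\<close> are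
  the corners of the clamp.\<close>

lemma DERIV_clamped_tail_integral:
  assumes W: "1 \<le> W" and v: "1 \<le> v" and n: "1 \<le> n" and ne: "v \<noteq> real n" "v \<noteq> real n / W"
  shows "((\<lambda>v. integral {max 1 (min W (real n / v))..W} (\<lambda>w. g w / w\<^sup>2)) has_real_derivative
    (if v \<le> real n \<and> real n \<le> v * W then g (real n / v) / real n else 0)) (at v)"
proof -
  let ?Q = "\<lambda>t. integral {t..W} (\<lambda>w. g w / w\<^sup>2)"
  consider "real n < v" | "v * W < real n" | "v < real n" "real n < v * W"
    using ne W by (auto simp: field_simps) linarith
  then show ?thesis
  proof cases
    case 1
    have "((\<lambda>v. ?Q 1) has_real_derivative 0) (at v)" by simp
    then have "((\<lambda>v. ?Q (max 1 (min W (real n / v)))) has_real_derivative 0) (at v)"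
    proof (rule has_field_derivative_transform_within_open[where S = "{real n<..}"])
      fix y assume "y \<in> {real n<..}"
      then have "real n / y \<le> 1" using n by (auto simp: field_simps)
      then show "?Q 1 = ?Q (max 1 (min W (real n / y)))" by (simp add: max_def min_le_iff_disj)
    qed (use 1 in auto)
    then show ?thesis using 1 by simp
  next
    case 2
    have "((\<lambda>v. ?Q W) has_real_derivative 0) (at v)" by simp
    then have "((\<lambda>v. ?Q (max 1 (min W (real n / v)))) has_real_derivative 0) (at v)"
    proof (rule has_field_derivative_transform_within_open[where S = "{0<..<real n / W}"])
      fix y assume "y \<in> {0<..<real n / W}"
      then have "W \<le> real n / y" using n W by (auto simp: field_simps)
      then show "?Q W = ?Q (max 1 (min W (real n / y)))" using W by (simp add: max_def min_def)
    qed (use 2 v W in \<open>auto simp: field_simps\<close>)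
    then show ?thesis using 2 by simp
  next
    case 3
    have nv: "1 < real n / v" "real n / v < W" using 3 v by (auto simp: field_simps)
    have d: "((\<lambda>v. real n / v) has_real_derivative - (real n / v\<^sup>2)) (at v)"
      using v by (auto intro!: derivative_eq_intros simp: power2_eq_square field_simps)
    have "((\<lambda>v. ?Q (real n / v)) has_real_derivative - (g (real n / v) / (real n / v)\<^sup>2) * - (real n / v\<^sup>2)) (at v)"
      by (rule DERIV_chain2[OF DERIV_tail_integral[OF nv] d])
    also have "- (g (real n / v) / (real n / v)\<^sup>2) * - (real n / v\<^sup>2) = g (real n / v) / real n"
      using v n by (simp add: power2_eq_square field_simps)
    finally have "((\<lambda>v. ?Q (max 1 (min W (real n / v)))) has_real_derivative g (real n / v) / real n) (at v)"
    proof (rule has_field_derivative_transform_within_open[where S = "{real n / W<..<real n}"])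
      fix y assume y: "y \<in> {real n / W<..<real n}"
      have "0 < real n / W" using n W by simp
      then have "0 < y" using y by (auto simp del: zero_less_divide_iff)
      then have "1 \<le> real n / y" "real n / y \<le> W" using y W by (auto simp: field_simps)
      then show "?Q (real n / y) = ?Q (max 1 (min W (real n / y)))" by (simp add: max_def min_def)
    qed (use 3 v W in \<open>auto simp: field_simps\<close>)
    then show ?thesis using 3 by simp
  qed
qed

text \<open>Gives the sum an index range independent of \<open>v\<close>, as needed for termwise
  differentiation and integration.\<close>

lemma dtrunc_indicator:
  assumes W: "1 \<le> W" and v: "1 \<le> v" and N: "v * W \<le> real N"
  shows "dtrunc W v = lam * ((\<Sum>n = 1..N. if v \<le> real n \<and> real n \<le> v * W then g (real n / v) / real n else 0)
     - integral {1..W} (\<lambda>w. g w / w))"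
proof -
  have vW: "0 \<le> v * W" using v W by simp
  have "(\<Sum>n = 1..N. if v \<le> real n \<and> real n \<le> v * W then g (real n / v) / real n else 0)
      = (\<Sum>n | n \<in> {1..N} \<and> (v \<le> real n \<and> real n \<le> v * W). g (real n / v) / real n)"
    by (rule sum.inter_filter[symmetric]) auto
  also have "{n. n \<in> {1..N} \<and> (v \<le> real n \<and> real n \<le> v * W)} = {nat \<lceil>v\<rceil>..nat \<lfloor>v * W\<rfloor>}"
  proof (intro set_eqI iffI)
    fix n assume "n \<in> {n. n \<in> {1..N} \<and> (v \<le> real n \<and> real n \<le> v * W)}"
    then show "n \<in> {nat \<lceil>v\<rceil>..nat \<lfloor>v * W\<rfloor>}" by (auto simp: le_nat_iff le_floor_iff nat_le_iff ceiling_le_iff)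
  next
    fix n assume n: "n \<in> {nat \<lceil>v\<rceil>..nat \<lfloor>v * W\<rfloor>}"
    then have "\<lceil>v\<rceil> \<le> int n" by (simp add: nat_le_iff)
    then have a: "v \<le> real n" by (simp add: ceiling_le_iff)
    have "real n \<le> real (nat \<lfloor>v * W\<rfloor>)" using n by simp
    also have "\<dots> \<le> v * W" using vW by (simp add: of_nat_nat)
    finally show "n \<in> {n. n \<in> {1..N} \<and> (v \<le> real n \<and> real n \<le> v * W)}" using a N v by auto
  qed
  finally show ?thesis by (simp add: dtrunc_def)
qed

text \<open>The values of \<open>v\<close> at which a node \<open>n / v\<close> crosses 1 or
  \<open>W\<close>, for \<open>n\<close> up to \<open>N\<close>.\<close>

definition kinks :: "real \<Rightarrow> nat \<Rightarrow> real set" where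
  "kinks W N = real ` {1..N} \<union> (\<lambda>n. real n / W) ` {1..N}"

lemma finite_kinks: "finite (kinks W N)"
  by (simp add: kinks_def)

lemma DERIV_trunc:
  assumes W: "1 \<le> W" and v: "1 < v" "v < U" "v \<notin> kinks W N" and N: "U * W \<le> real N"
  shows "(trunc W has_real_derivative dtrunc W v) (at v)"
proof -
  have vN: "y * W \<le> real N" if "y < U" for y
    using mult_right_mono[of y U W] that W N by linarith
  have "((\<lambda>v. lam * (1/2 * integral {1..W} (\<lambda>w. g w / w\<^sup>2) - v * integral {1..W} (\<lambda>w. g w / w)
     + (\<Sum>n = 1..N. integral {max 1 (min W (real n / v))..W} (\<lambda>w. g w / w\<^sup>2))))
    has_real_derivative lam * (0 - 1 * integral {1..W} (\<lambda>w. g w / w) +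
     (\<Sum>n = 1..N. if v \<le> real n \<and> real n \<le> v * W then g (real n / v) / real n else 0))) (at v)"
    by (intro DERIV_cmult DERIV_add DERIV_diff DERIV_const DERIV_cmult_right DERIV_ident DERIV_sum
        DERIV_clamped_tail_integral W)
       (use v in \<open>auto simp: kinks_def\<close>)
  also have "lam * (0 - 1 * integral {1..W} (\<lambda>w. g w / w) +
     (\<Sum>n = 1..N. if v \<le> real n \<and> real n \<le> v * W then g (real n / v) / real n else 0)) = dtrunc W v"
    using dtrunc_indicator[OF W, of v N] v vN[of v] by simp
  finally show ?thesis
    by (rule has_field_derivative_transform_within_open[where S = "{1<..<U}"])
       (use v in \<open>auto simp only: open_greaterThanLessThan greaterThanLessThan_iff less_imp_le
         intro!: trunc_expansion[symmetric] vN W\<close>)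
qed

lemma continuous_on_trunc:
  assumes W: "1 \<le> W"
  shows "continuous_on {1..U} (trunc W)"
proof -
  define N where "N = nat \<lceil>U * W\<rceil>"
  have N: "U * W \<le> real N" unfolding N_def by (rule real_nat_ceiling_ge)
  have vN: "y * W \<le> real N" if "y \<le> U" for y
    using mult_right_mono[of y U W] that W N by linarith
  have "continuous_on {1..U} (\<lambda>v. lam * (1/2 * integral {1..W} (\<lambda>w. g w / w\<^sup>2) - v * integral {1..W} (\<lambda>w. g w / w)
     + (\<Sum>n = 1..N. integral {max 1 (min W (real n / v))..W} (\<lambda>w. g w / w\<^sup>2))))"
    by (intro continuous_intros continuous_on_compose2[OF continuous_on_tail_integral[of W]])
       (use W in auto)
  then show ?thesis
    by (rule continuous_on_eq) (auto simp only: atLeastAtMost_iff intro!: trunc_expansion[symmetric] vN W)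
qed

text \<open>\<open>trunc W\<close> is continuous also at the kinks, so the fundamental theorem with
  finitely many exceptions applies.\<close>

lemma dtrunc_has_integral:
  assumes W: "1 \<le> W" and st: "1 \<le> s" "s \<le> t"
  shows "(dtrunc W has_integral (trunc W t - trunc W s)) {s..t}"
proof (rule fundamental_theorem_of_calculus_interior_strong[OF finite_kinks[of W "nat \<lceil>t * W\<rceil>"] st(2)])
  show "continuous_on {s..t} (trunc W)"
    by (rule continuous_on_subset[OF continuous_on_trunc[OF W, of t]]) (use st in auto)
  fix u assume "u \<in> {s<..<t} - kinks W (nat \<lceil>t * W\<rceil>)"
  then show "(trunc W has_vector_derivative dtrunc W u) (at u)"
    using DERIV_trunc[OF W, of u t "nat \<lceil>t * W\<rceil>"] st real_nat_ceiling_ge[of "t * W"]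
    by (simp add: has_real_derivative_iff_has_vector_derivative)
qed

lemma trunc_increment_le:
  assumes W: "1 \<le> W" and st: "1 \<le> s" "s \<le> t" and c: "\<And>u. u \<in> {s..t} \<Longrightarrow> \<bar>dtrunc W u\<bar> \<le> c"
  shows "\<bar>trunc W t - trunc W s\<bar> \<le> c * (t - s)"
  using abs_integral_le_const[of "dtrunc W" s t c] dtrunc_has_integral[OF W st] st c
  by (auto simp: has_integral_iff)

text \<open>A derivative bound uniform in \<open>W\<close> survives the limit, although
  \<open>g\<close> itself is never differentiated. The threshold \<open>W0\<close> admits bounds
  that hold only for large truncations.\<close>

lemma g_increment_le:
  assumes st: "1 \<le> s" "s \<le> t" and c: "\<And>W u. W0 \<le> W \<Longrightarrow> 1 \<le> W \<Longrightarrow> u \<in> {s..t} \<Longrightarrow> \<bar>dtrunc W u\<bar> \<le> c"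
  shows "\<bar>g t - g s\<bar> \<le> c * (t - s)"
proof (rule le_of_le_plus_inverse[of "max 1 W0" _ _ "lam\<^sup>2 / 2"])
  fix W assume W: "max 1 W0 \<le> W"
  have "\<bar>trunc W t - trunc W s\<bar> \<le> c * (t - s)" using W st c by (intro trunc_increment_le) auto
  moreover have "\<bar>g t - trunc W t\<bar> \<le> lam\<^sup>2 / 4 / W" "\<bar>g s - trunc W s\<bar> \<le> lam\<^sup>2 / 4 / W"
    using W st by (intro trunc_error_crude; simp)+
  moreover have "lam\<^sup>2 / 2 / W = lam\<^sup>2 / 4 / W + lam\<^sup>2 / 4 / W" by (simp add: field_simps)
  ultimately show "\<bar>g t - g s\<bar> \<le> c * (t - s) + lam\<^sup>2 / 2 / W" by linarith
qed

lemma g_le_of_truncations: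
  assumes v: "1 \<le> v" and c: "\<And>W. 1 \<le> W \<Longrightarrow> \<bar>integral {1..W} (\<lambda>w. saw (v * w) * (g w / w\<^sup>2))\<bar> \<le> c"
  shows "\<bar>g v\<bar> \<le> \<bar>lam\<bar> * c"
proof (rule le_of_le_plus_inverse[of 1 _ _ "lam\<^sup>2 / 4"])
  fix W :: real assume W: "1 \<le> W"
  have "\<bar>trunc W v\<bar> \<le> \<bar>lam\<bar> * c"
    using c[OF W] by (simp add: trunc_def abs_mult mult_left_mono)
  with trunc_error_crude[OF W v] show "\<bar>g v\<bar> \<le> \<bar>lam\<bar> * c + lam\<^sup>2 / 4 / W" by linarith
qed

end

subsection \<open>A priori bounds\<close>

lemma abs_integral_le_ln:
  fixes f :: "real \<Rightarrow> real"
  assumes f: "f integrable_on {1..W}" and W: "1 \<le> W"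
    and bnd: "\<And>w. w \<in> {1..W} \<Longrightarrow> \<bar>f w\<bar> \<le> c / w"
  shows "\<bar>integral {1..W} f\<bar> \<le> c * ln W"
proof -
  have "((\<lambda>w. c / w) has_integral (c * ln W - c * ln 1)) {1..W}"
  proof (rule fundamental_theorem_of_calculus)
    fix w assume "w \<in> {1..W}"
    then have "((\<lambda>w. c * ln w) has_real_derivative c / w) (at w within {1..W})"
      by (auto intro!: derivative_eq_intros simp: divide_inverse)
    then show "((\<lambda>w. c * ln w) has_vector_derivative c / w) (at w within {1..W})"
      by (simp add: has_real_derivative_iff_has_vector_derivative)
  qed (use W in auto)
  then have "norm (integral {1..W} f) \<le> c * ln W - c * ln 1"
    using bnd f by (metis has_integral_iff Henstock_Kurzweil_Integration.integral_norm_bound_integral real_norm_def)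
  then show ?thesis by simp
qed

text \<open>Bernoulli's inequality bounds \<open>1 - (s / t) ^ k\<close> by
  \<open>k * (1 - s / t)\<close>. This yields the increment bounds required of quotients in
  oscillatory integrals and Riemann sums.\<close>

lemma abs_divide_power_diff_le:
  fixes f :: "real \<Rightarrow> real"
  assumes s: "1 \<le> s" "s \<le> t"
  shows "\<bar>f t / t ^ k - f s / s ^ k\<bar> \<le> (\<bar>f t - f s\<bar> + \<bar>f s\<bar> * real k * (t - s) / s) / s ^ k"
proof -
  have pos: "0 < s" "0 < t" using s by auto
  have kt: "s ^ k \<le> t ^ k" using s by (intro power_mono) auto
  have "1 + real k * (s / t - 1) \<le> (1 + (s / t - 1)) ^ k"
    using pos by (intro Bernoulli_inequality) auto
  then have "1 - (s / t) ^ k \<le> real k * (1 - s / t)" by (simp add: algebra_simps)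
  also have "\<dots> \<le> real k * ((t - s) / s)"
  proof (intro mult_left_mono)
    have "1 - s / t = (t - s) / t" using pos by (simp add: field_simps)
    also have "\<dots> \<le> (t - s) / s" using s pos by (intro divide_left_mono) auto
    finally show "1 - s / t \<le> (t - s) / s" .
  qed simp
  finally have k: "1 - (s / t) ^ k \<le> real k * ((t - s) / s)" .
  have st: "(s / t) ^ k \<le> 1" using s pos by (intro power_le_one) auto
  have "f t / t ^ k - f s / s ^ k = (f t - f s) / t ^ k - f s * (1 - (s / t) ^ k) / s ^ k"
    using pos by (simp add: power_divide field_simps)
  also have "\<bar>\<dots>\<bar> \<le> \<bar>(f t - f s) / t ^ k\<bar> + \<bar>f s * (1 - (s / t) ^ k) / s ^ k\<bar>" by (rule abs_triangle_ineq4)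
  also have "\<dots> = \<bar>f t - f s\<bar> / t ^ k + \<bar>f s\<bar> * (1 - (s / t) ^ k) / s ^ k"
    using pos st by (simp add: abs_mult)
  also have "\<dots> \<le> \<bar>f t - f s\<bar> / s ^ k + \<bar>f s\<bar> * (real k * ((t - s) / s)) / s ^ k"
    using pos kt k by (intro add_mono divide_left_mono divide_right_mono mult_left_mono) auto
  finally show ?thesis by (simp add: add_divide_distrib)
qed

context saw_eigenfunction
begin

abbreviation R :: real where "R \<equiv> \<bar>lam\<bar>"

abbreviation L :: real where "L \<equiv> ln \<bar>lam\<bar>"

abbreviation \<eta> :: real where "\<eta> \<equiv> 1 / (20 * ln \<bar>lam\<bar>)"

lemma L_ge: "2/3 \<le> L"
  using ln2_ge_two_thirds ln_mono[of 2 R] lam_ge by linarith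

lemma eta_pos: "0 < \<eta>"
  using L_ge by simp

text \<open>From \<open>2 \<le> R\<close> and \<open>2/3 \<le> L\<close>; used to absorb terms
  linear in \<open>R\<close> into multiples of \<open>R^2 * L\<close>.\<close>

lemma R_le: "R \<le> 3/4 * (R\<^sup>2 * L)"
proof -
  have "2 * (2/3) * R \<le> R * L * R" using lam_ge L_ge by (intro mult_mono) auto
  then show ?thesis by (simp add: power2_eq_square algebra_simps)
qed

lemma R2L_nonneg: "0 \<le> R\<^sup>2 * L"
  using L_ge by simp

lemma L_le_square: "L \<le> 3/2 * L\<^sup>2"
  using mult_right_mono[OF L_ge, of L] L_ge by (simp add: power2_eq_square)

section \<open>First pass: from boundedness to Lipschitz continuity and decay like 1/v\<close>

lemma integrable_g_over: "1 \<le> p \<Longrightarrow> (\<lambda>w. g w / w) integrable_on {p..q}"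
  by (intro integrable_continuous_interval) (auto intro!: continuous_intros)

text \<open>Only \<open>\<bar>g\<bar> \<le> R / 2\<close> is used: sum and integral are bounded
  separately, each costing a harmonic factor that grows with \<open>ln W\<close>.\<close>

lemma dtrunc_le_log:
  assumes W: "1 \<le> W" and u: "1 \<le> u"
  shows "\<bar>dtrunc W u\<bar> \<le> R\<^sup>2 * (1 + ln W)"
proof -
  have "\<bar>\<Sum>n = nat \<lceil>u\<rceil>..nat \<lfloor>u * W\<rfloor>. g (real n / u) / real n\<bar>
      \<le> (\<Sum>n = nat \<lceil>u\<rceil>..nat \<lfloor>u * W\<rfloor>. R / 2 * (1 / real n))"
    using divide_right_mono[OF g_le] by (intro order.trans[OF sum_abs] sum_mono) simp
  also have "\<dots> \<le> R / 2 * (1 + ln W)"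
    unfolding sum_distrib_left[symmetric] using sum_inverse_le_ln[OF u W] by (intro mult_left_mono) auto
  finally have 1: "\<bar>\<Sum>n = nat \<lceil>u\<rceil>..nat \<lfloor>u * W\<rfloor>. g (real n / u) / real n\<bar> \<le> R / 2 * (1 + ln W)" .
  have "\<bar>integral {1..W} (\<lambda>w. g w / w)\<bar> \<le> R / 2 * ln W"
    using g_le W by (intro abs_integral_le_ln integrable_g_over) (auto simp only: abs_divide atLeastAtMost_iff intro!: frac_le)
  also have "\<dots> \<le> R / 2 * (1 + ln W)" by (intro mult_left_mono) auto
  finally have 2: "\<bar>integral {1..W} (\<lambda>w. g w / w)\<bar> \<le> R / 2 * (1 + ln W)" .
  have "\<bar>dtrunc W u\<bar> \<le> R * (R / 2 * (1 + ln W) + R / 2 * (1 + ln W))"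
    unfolding dtrunc_def abs_mult using 1 2 by (intro mult_left_mono) linarith+
  then show ?thesis by (simp add: power2_eq_square algebra_simps)
qed

text \<open>The truncation error shrinks like \<open>1 / W\<close> while the derivative bound grows
  like \<open>ln W\<close>; the choice \<open>W = 1 / (t - s)\<close> balances them, and the square
  root absorbs the logarithm.\<close>

lemma g_hoelder:
  assumes st: "1 \<le> s" "s \<le> t" "t \<le> s + 1"
  shows "\<bar>g t - g s\<bar> \<le> 3 * R\<^sup>2 * sqrt (t - s)"
proof (cases "s = t")
  case False
  define d where "d = t - s"
  have d: "0 < d" "d \<le> 1" using st False by (auto simp: d_def)
  define W where "W = 1 / d"
  have W: "1 \<le> W" using d by (simp add: W_def)
  have sd: "sqrt d * sqrt d = d" "0 < sqrt d" using d by auto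
  have "d \<le> sqrt d" using mult_right_mono[of "sqrt d" 1 "sqrt d"] d sd by simp
  have "ln (sqrt W) \<le> sqrt W - 1" using W by (intro ln_le_minus_one) auto
  then have "1 + ln W \<le> 2 * sqrt W" using W by (simp add: ln_sqrt)
  then have "(1 + ln W) * d \<le> 2 * sqrt W * d" using d by (intro mult_right_mono) auto
  also have "\<dots> = 2 * sqrt d" using sd by (simp add: W_def real_sqrt_divide field_simps)
  finally have lnd: "(1 + ln W) * d \<le> 2 * sqrt d" .
  have mono: "\<bar>dtrunc W u\<bar> \<le> R\<^sup>2 * (1 + ln W)" if "u \<in> {s..t}" for u
    using that st W by (intro dtrunc_le_log) auto
  have "\<bar>trunc W t - trunc W s\<bar> \<le> R\<^sup>2 * (1 + ln W) * (t - s)"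
    using W st mono by (intro trunc_increment_le) auto
  also have "\<dots> \<le> R\<^sup>2 * (2 * sqrt d)"
    unfolding d_def[symmetric] mult.assoc using lnd by (intro mult_left_mono) auto
  finally have 1: "\<bar>trunc W t - trunc W s\<bar> \<le> R\<^sup>2 * (2 * sqrt d)" .
  have err: "\<bar>g y - trunc W y\<bar> \<le> R\<^sup>2 * sqrt d / 4" if "1 \<le> y" for y
  proof -
    have "\<bar>g y - trunc W y\<bar> \<le> lam\<^sup>2 / 4 / W" using W that by (intro trunc_error_crude)
    also have "\<dots> = R\<^sup>2 * d / 4" by (simp add: W_def)
    also have "\<dots> \<le> R\<^sup>2 * sqrt d / 4" using \<open>d \<le> sqrt d\<close> by (intro divide_right_mono mult_left_mono) auto
    finally show ?thesis .
  qed
  have "0 \<le> R\<^sup>2 * sqrt d" using sd by simp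
  then have "\<bar>g t - g s\<bar> \<le> 3 * (R\<^sup>2 * sqrt d)" using 1 err[of s] err[of t] st by linarith
  then show ?thesis by (simp add: d_def)
qed simp

text \<open>Here \<open>c\<close> bounds the variation of \<open>g\<close> over one period
  \<open>1 / v\<close> of the kernel, so regularity of \<open>g\<close> becomes decay. The weight
  \<open>1 / w^2\<close> contributes \<open>R / v\<close> and the incomplete period
  \<open>R / (4 * v)\<close>.\<close>

lemma saw_integral_bound:
  assumes v: "1 \<le> v" and W: "1 \<le> W"
    and c: "\<And>s t. 1 \<le> s \<Longrightarrow> s \<le> t \<Longrightarrow> t \<le> s + 1 / v \<Longrightarrow> \<bar>g t - g s\<bar> \<le> c"
  shows "\<bar>integral {1..W} (\<lambda>w. saw (v * w) * (g w / w\<^sup>2))\<bar> \<le> c + 5/4 * R / v"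
proof -
  have "\<bar>integral {1..W} (\<lambda>w. saw (w / (1 / v)) * (g w / w\<^sup>2))\<bar> \<le> R / 2 * (1 / v) / 2 + (c + R / v)"
  proof (rule oscillatory_integral_bound)
    show "continuous_on {1..W} (\<lambda>w. g w / w\<^sup>2)" by (auto intro!: continuous_intros)
    show "\<bar>g w / w\<^sup>2\<bar> \<le> R / 2" if "w \<in> {1..W}" for w
      using g_le[of w] that frac_le[of "R / 2" "\<bar>g w\<bar>" 1 "w\<^sup>2"] by (auto simp: one_le_power)
    fix s t assume st: "1 \<le> s" "s \<le> t" "t \<le> s + 1 / v"
    have "\<bar>g t / t\<^sup>2 - g s / s\<^sup>2\<bar> \<le> (\<bar>g t - g s\<bar> + \<bar>g s\<bar> * real 2 * (t - s) / s) / s\<^sup>2"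
      using st by (intro abs_divide_power_diff_le)
    also have "\<dots> \<le> (c + R / v) / s\<^sup>2"
    proof (intro divide_right_mono add_mono c st)
      have "\<bar>g s\<bar> * real 2 * (t - s) / s \<le> R / 2 * real 2 * (1 / v) / 1"
        using st v by (intro frac_le mult_mono g_le) auto
      then show "\<bar>g s\<bar> * real 2 * (t - s) / s \<le> R / v" by simp
    qed simp
    finally show "\<bar>g t / t\<^sup>2 - g s / s\<^sup>2\<bar> \<le> (c + R / v) / s\<^sup>2" .
  qed (use v W in \<open>simp_all only: abs_saw_le saw_mean_zero saw_measurable zero_less_divide_1_iff
         divide_le_eq_1 order_refl, auto\<close>)
  then show ?thesis by (simp add: mult.commute)
qed

text \<open>Over a period \<open>1 / v\<close> the Hoelder bound gives variation of order
  \<open>R^2 * v powr (-1/2)\<close>; the eigenvalue supplies the third factor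
  \<open>R\<close>.\<close>

lemma g_decay_half:
  assumes v: "1 \<le> v"
  shows "\<bar>g v\<bar> \<le> 5 * R ^ 3 * v powr (-1/2)"
proof -
  have x: "1 / v \<le> sqrt (1 / v)"
    using v mult_right_mono[of "sqrt (1 / v)" 1 "sqrt (1 / v)"] by simp
  have "\<bar>g v\<bar> \<le> R * (3 * R\<^sup>2 * sqrt (1 / v) + 5/4 * R / v)"
  proof (intro g_le_of_truncations saw_integral_bound v)
    fix s t assume st: "1 \<le> s" "s \<le> t" "t \<le> s + 1 / v"
    have "1 / v \<le> 1" using v by simp
    then have "\<bar>g t - g s\<bar> \<le> 3 * R\<^sup>2 * sqrt (t - s)" using st by (intro g_hoelder) linarith+
    also have "\<dots> \<le> 3 * R\<^sup>2 * sqrt (1 / v)" using st by (intro mult_left_mono) auto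
    finally show "\<bar>g t - g s\<bar> \<le> 3 * R\<^sup>2 * sqrt (1 / v)" .
  qed
  also have "\<dots> \<le> R * (5 * R\<^sup>2 * sqrt (1 / v))"
  proof (intro mult_left_mono)
    have "1 * R \<le> R * R" using lam_ge by (intro mult_right_mono) auto
    then have "5/4 * R \<le> 2 * R\<^sup>2" by (simp add: power2_eq_square)
    from mult_mono[OF this x] have "5/4 * R * (1 / v) \<le> 2 * R\<^sup>2 * sqrt (1 / v)"
      using v by (simp only: zero_le_mult_iff) simp
    then show "3 * R\<^sup>2 * sqrt (1 / v) + 5/4 * R / v \<le> 5 * R\<^sup>2 * sqrt (1 / v)" by (simp add: mult_ac)
  qed simp
  also have "\<dots> = 5 * R ^ 3 * v powr (-1/2)"
    using v by (simp add: power2_eq_square power3_eq_cube powr_minus powr_half_sqrt real_sqrt_divide field_simps)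
  finally show ?thesis .
qed

text \<open>Interpolation with \<open>P = R\<close>; the constant 5 is absorbed because
  \<open>R ^ 3\<close> is at least 8.\<close>

lemma g_decay_eta:
  assumes v: "1 \<le> v"
  shows "\<bar>g v\<bar> \<le> 2 * R * v powr (-\<eta>)"
proof (rule interpolated_decay[OF lam_ge v])
  show "\<bar>g v\<bar> \<le> R" using g_le[of v] lam_ge by linarith
  have "5 \<le> R ^ 3" using power_mono[OF lam_ge, of 3] by simp
  then have "5 * R ^ 3 \<le> R ^ 3 * R ^ 3" by (intro mult_right_mono) auto
  then have "5 * R ^ 3 * v powr (-1/2) \<le> R * R ^ 5 * v powr (-1/2)"
    by (intro mult_right_mono) (auto simp: eval_nat_numeral mult.assoc)
  then show "\<bar>g v\<bar> \<le> R * R ^ 5 * v powr (-1/2)" using g_decay_half[OF v] by linarith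
qed simp

text \<open>The decay \<open>w powr (-\<eta>)\<close> makes the integral converge at the cost
  \<open>1 / \<eta> = 20 * L\<close>, so the bound is uniform in \<open>W\<close>.\<close>

lemma abs_integral_g_over_le:
  assumes W: "1 \<le> W"
  shows "\<bar>integral {1..W} (\<lambda>w. g w / w)\<bar> \<le> 40 * R * L"
proof -
  have "\<bar>integral {1..W} (\<lambda>w. g w / w)\<bar> \<le> 2 * R * 1 powr (-\<eta>) / \<eta>"
  proof (intro abs_integral_le_powr integrable_g_over W eta_pos)
    fix w assume w: "w \<in> {1..W}"
    have "\<bar>g w / w\<bar> \<le> 2 * R * w powr (-\<eta>) / w" using g_decay_eta[of w] w by (auto simp: divide_right_mono)
    also have "\<dots> = 2 * R * w powr (-1 - \<eta>)" using w by (simp add: powr_diff powr_minus field_simps)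
    finally show "\<bar>g w / w\<bar> \<le> 2 * R * w powr (-1 - \<eta>)" .
  qed auto
  then show ?thesis by simp
qed

text \<open>The argument of \<open>dtrunc_le_log\<close> with \<open>g_decay_eta\<close> in place of
  the trivial bound: the factor growing with \<open>ln W\<close> becomes a multiple of
  \<open>L\<close>.\<close>

lemma dtrunc_le_const:
  assumes W: "1 \<le> W" and u: "1 \<le> u"
  shows "\<bar>dtrunc W u\<bar> \<le> 90 * (R\<^sup>2 * L)"
proof -
  let ?I = "{nat \<lceil>u\<rceil>..nat \<lfloor>u * W\<rfloor>}"
  have "\<bar>\<Sum>n \<in> ?I. g (real n / u) / real n\<bar> \<le> (\<Sum>n \<in> ?I. 2 * R * ((real n / u) powr (-\<eta>) / real n))"
  proof (intro order.trans[OF sum_abs] sum_mono)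
    fix n assume "n \<in> ?I"
    then have "u \<le> real n" by (simp add: nat_le_iff ceiling_le_iff)
    then have "1 \<le> real n / u" using u by simp
    from divide_right_mono[OF g_decay_eta[OF this], of "real n"]
    show "\<bar>g (real n / u) / real n\<bar> \<le> 2 * R * ((real n / u) powr (-\<eta>) / real n)" by simp
  qed
  also have "\<dots> \<le> 2 * R * (1 + 1 / \<eta>)"
    unfolding sum_distrib_left[symmetric] using sum_scaled_powr_le[OF eta_pos u] by (intro mult_left_mono) auto
  also have "\<dots> = 2 * R + 40 * R * L" by (simp add: algebra_simps)
  finally have 1: "\<bar>\<Sum>n \<in> ?I. g (real n / u) / real n\<bar> \<le> 2 * R + 40 * R * L" .
  have "\<bar>dtrunc W u\<bar> \<le> R * (2 * R + 40 * R * L + 40 * R * L)"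
    unfolding dtrunc_def abs_mult using 1 abs_integral_g_over_le[OF W] by (intro mult_left_mono) linarith+
  also have "\<dots> = 2 * R\<^sup>2 * 1 + 80 * (R\<^sup>2 * L)" by (simp add: power2_eq_square algebra_simps)
  also have "2 * R\<^sup>2 * 1 \<le> 2 * R\<^sup>2 * (3/2 * L)" using L_ge by (intro mult_left_mono) auto
  also have "2 * R\<^sup>2 * (3/2 * L) + 80 * (R\<^sup>2 * L) = 83 * (R\<^sup>2 * L)" by simp
  also have "\<dots> \<le> 90 * (R\<^sup>2 * L)" using L_ge by (intro mult_right_mono) auto
  finally show ?thesis by simp
qed

lemma g_lipschitz:
  assumes "1 \<le> s" "s \<le> t"
  shows "\<bar>g t - g s\<bar> \<le> 90 * (R\<^sup>2 * L) * (t - s)"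
  using assms dtrunc_le_const by (intro g_increment_le[where ?W0.0 = 1]) auto

text \<open>The Lipschitz bound over one period \<open>1 / v\<close>, fed into
  \<open>saw_integral_bound\<close>, improves the exponent from 1/2 to 1.\<close>

lemma g_decay:
  assumes v: "1 \<le> v"
  shows "\<bar>g v\<bar> \<le> 91 * (R ^ 3 * L) / v"
proof -
  have "\<bar>g v\<bar> \<le> R * (90 * (R\<^sup>2 * L) * (1 / v) + 5/4 * R / v)"
  proof (intro g_le_of_truncations saw_integral_bound v)
    fix s t assume st: "1 \<le> s" "s \<le> t" "t \<le> s + 1 / v"
    have "\<bar>g t - g s\<bar> \<le> 90 * (R\<^sup>2 * L) * (t - s)" using st by (intro g_lipschitz)
    also have "\<dots> \<le> 90 * (R\<^sup>2 * L) * (1 / v)" using st L_ge by (intro mult_left_mono) auto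
    finally show "\<bar>g t - g s\<bar> \<le> 90 * (R\<^sup>2 * L) * (1 / v)" .
  qed
  also have "\<dots> = R * (90 * (R\<^sup>2 * L) + 5/4 * R) / v" by (simp add: algebra_simps add_divide_distrib)
  also have "\<dots> \<le> R * (91 * (R\<^sup>2 * L)) / v"
    using R_le R2L_nonneg v by (intro divide_right_mono mult_left_mono; linarith)
  also have "\<dots> = 91 * (R ^ 3 * L) / v" by (simp add: power2_eq_square power3_eq_cube)
  finally show ?thesis .
qed

section \<open>Second pass: decay of the derivative\<close>

lemma euler_maclaurin_g:
  fixes m :: "real \<Rightarrow> real"
  assumes u: "1 \<le> u" and V: "1 \<le> V" and m0: "\<And>s. 1 \<le> s \<Longrightarrow> 0 \<le> m s"
    and m: "\<And>s t. 1 \<le> s \<Longrightarrow> s \<le> t \<Longrightarrow> \<bar>g t - g s\<bar> \<le> m s * (t - s)"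
  shows "\<bar>(\<Sum>n = nat \<lceil>u\<rceil>..nat \<lfloor>u * V\<rfloor>. g (real n / u) / real n) - integral {1..V} (\<lambda>w. g w / w)\<bar>
     \<le> (3/2 * R + (\<Sum>n = nat \<lceil>u\<rceil>..nat \<lfloor>u * V\<rfloor>. (m (real n / u) + R / 2 * (u / real n)) / real n)) / u"
proof -
  \<comment> \<open>Lipschitz constant of \<open>g w / w\<close> to the right of \<open>s\<close>:
    \<open>m\<close> covers the increment of \<open>g\<close>, the term \<open>R / 2 / s\<close>
    that of \<open>1 / w\<close>.\<close>
  define M where "M s = (m s + R / 2 / s) / s" for s
  have node: "1 \<le> real n / u" "0 < real n" if "n \<in> {nat \<lceil>u\<rceil>..nat \<lfloor>u * V\<rfloor>}" for n
  proof -
    have "u \<le> real n" using that by (simp add: nat_le_iff ceiling_le_iff)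
    then show "1 \<le> real n / u" "0 < real n" using u by auto
  qed
  have "\<bar>(\<Sum>n = nat \<lceil>u\<rceil>..nat \<lfloor>u * V\<rfloor>. g (real n / u) / (real n / u) / u) - integral {1..V} (\<lambda>w. g w / w)\<bar>
     \<le> (3 * (R / 2) + (\<Sum>n = nat \<lceil>u\<rceil>..nat \<lfloor>u * V\<rfloor>. M (real n / u) / u)) / u"
  proof (rule riemann_sum_error[OF u V])
    show "continuous_on {1..V} (\<lambda>w. g w / w)" by (auto intro!: continuous_intros)
    show "\<bar>g w / w\<bar> \<le> R / 2" if "w \<in> {1..V}" for w
      using g_le[of w] that frac_le[of "R / 2" "\<bar>g w\<bar>" 1 w] by auto
    show "0 \<le> M s" if "1 \<le> s" for s using m0[OF that] that by (simp add: M_def)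
    fix s t :: real assume st: "1 \<le> s" "s \<le> t"
    have "\<bar>g t / t ^ 1 - g s / s ^ 1\<bar> \<le> (\<bar>g t - g s\<bar> + \<bar>g s\<bar> * real 1 * (t - s) / s) / s ^ 1"
      using st by (intro abs_divide_power_diff_le)
    also have "\<dots> \<le> (m s * (t - s) + R / 2 * 1 * (t - s) / s) / s ^ 1"
      using st g_le by (intro divide_right_mono add_mono m mult_mono) auto
    also have "\<dots> = (t - s) * M s" using st by (simp add: M_def field_simps)
    finally show "\<bar>g t / t - g s / s\<bar> \<le> (t - s) * M s" by simp
  qed
  also have "(\<Sum>n = nat \<lceil>u\<rceil>..nat \<lfloor>u * V\<rfloor>. g (real n / u) / (real n / u) / u)
      = (\<Sum>n = nat \<lceil>u\<rceil>..nat \<lfloor>u * V\<rfloor>. g (real n / u) / real n)"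
    using u by (intro sum.cong) auto
  also have "(\<Sum>n = nat \<lceil>u\<rceil>..nat \<lfloor>u * V\<rfloor>. M (real n / u) / u)
      = (\<Sum>n = nat \<lceil>u\<rceil>..nat \<lfloor>u * V\<rfloor>. (m (real n / u) + R / 2 * (u / real n)) / real n)"
    using u node by (intro sum.cong) (auto simp: M_def)
  finally show ?thesis by simp
qed


text \<open>Split at \<open>V = sqrt u\<close>. Up to \<open>V\<close> the sum approximates the
  integral with error \<open>O (ln V / u)\<close> from the Lipschitz bound; beyond \<open>V\<close>
  sum and integral are each \<open>O (1 / V)\<close> by the decay of \<open>g\<close>. Only
  truncations with \<open>W\<close> at least \<open>sqrt u\<close> are needed, since
  \<open>W\<close> tends to infinity afterwards.\<close>

lemma dtrunc_decay_half:
  assumes u: "1 \<le> u" and W: "sqrt u \<le> W"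
  shows "\<bar>dtrunc W u\<bar> \<le> 90 * (R\<^sup>2 * L) * R ^ 5 * u powr (-1/2)"
proof -
  define V where "V = sqrt u"
  have V: "1 \<le> V" "V \<le> W" "V * V = u" using u W by (auto simp: V_def)
  define A B where "A = 91 * (R ^ 3 * L)" and "B = 90 * (R\<^sup>2 * L)"
  have AB: "0 \<le> A" "0 \<le> B" using L_ge by (auto simp: A_def B_def)
  have RB: "3/2 * R \<le> B" "R / 2 \<le> B" using R_le R2L_nonneg unfolding B_def by linarith+
  define a c d where "a = nat \<lceil>u\<rceil>" and "c = nat \<lfloor>u * V\<rfloor>" and "d = nat \<lfloor>u * W\<rfloor>"
  have uV: "u \<le> u * V" "u * V \<le> u * W" using u V by auto
  have cd: "c \<le> d" unfolding c_def d_def using uV by (intro nat_mono floor_mono)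
  \<comment> \<open>Slack of one, so that the sum splits even when its first range is empty.\<close>
  have ac: "a \<le> c + 1"
  proof -
    have "\<lceil>u\<rceil> \<le> \<lfloor>u * V\<rfloor> + 1" using uV by linarith
    then show ?thesis unfolding a_def c_def using u uV by linarith
  qed
  let ?f = "\<lambda>n. g (real n / u) / real n"
  have split: "(\<Sum>n = a..d. ?f n) = (\<Sum>n = a..c. ?f n) + (\<Sum>n = c + 1..d. ?f n)"
    using ac cd sum.ub_add_nat[of a c ?f "d - c"] by simp
  have isplit: "integral {1..W} (\<lambda>w. g w / w) = integral {1..V} (\<lambda>w. g w / w) + integral {V..W} (\<lambda>w. g w / w)"
    using V by (intro Henstock_Kurzweil_Integration.integral_combine[symmetric] integrable_g_over) auto
  have e1: "\<bar>(\<Sum>n = a..c. ?f n) - integral {1..V} (\<lambda>w. g w / w)\<bar> \<le> 3 * B / V"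
  proof -
    have "\<bar>(\<Sum>n = a..c. ?f n) - integral {1..V} (\<lambda>w. g w / w)\<bar>
        \<le> (3/2 * R + (\<Sum>n = a..c. (B + R / 2 * (u / real n)) / real n)) / u"
      unfolding a_def c_def using AB(2) g_lipschitz
      by (intro euler_maclaurin_g u V) (auto simp only: B_def)
    also have "\<dots> \<le> (B + (\<Sum>n = a..c. 2 * B * (1 / real n))) / u"
    proof (intro divide_right_mono add_mono sum_mono RB)
      fix n assume "n \<in> {a..c}"
      then have n: "u \<le> real n" unfolding a_def by (simp add: nat_le_iff ceiling_le_iff)
      have "R / 2 * (u / real n) \<le> R / 2 * 1" using n u by (intro mult_left_mono) auto
      then have "B + R / 2 * (u / real n) \<le> 2 * B" using RB by linarith
      then show "(B + R / 2 * (u / real n)) / real n \<le> 2 * B * (1 / real n)"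
        by (simp add: divide_right_mono)
    qed (use u in auto)
    also have "\<dots> \<le> (B + 2 * B * (1 + ln V)) / u"
      unfolding sum_distrib_left[symmetric] a_def c_def
      using sum_inverse_le_ln[OF u V(1)] AB u by (intro divide_right_mono add_left_mono mult_left_mono) auto
    \<comment> \<open>With \<open>1 + ln V \<le> V\<close> and \<open>u = V * V\<close> the
      logarithm costs nothing compared with \<open>1 / V\<close>.\<close>
    also have "\<dots> \<le> (B * V + 2 * B * V) / u"
    proof (intro divide_right_mono add_mono mult_left_mono)
      show "1 + ln V \<le> V" using ln_le_minus_one[of V] V by simp
    qed (use AB u V in \<open>auto simp: mult_le_cancel_left1\<close>)
    also have "\<dots> = 3 * B * V / (V * V)" using V by (simp add: algebra_simps)
    also have "\<dots> = 3 * B / V" using V(1) by simp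
    finally show ?thesis .
  qed
  have e2: "\<bar>\<Sum>n = c + 1..d. ?f n\<bar> \<le> 2 * A / V"
  proof -
    have c: "u * V \<le> real (c + 1)" unfolding c_def by linarith
    have c1: "1 \<le> c + 1" by simp
    have "\<bar>\<Sum>n = c + 1..d. ?f n\<bar> \<le> (\<Sum>n = c + 1..d. A * u * real n powr (-1 - 1))"
    proof (intro order.trans[OF sum_abs] sum_mono)
      fix n assume "n \<in> {c + 1..d}"
      then have "u * V \<le> real n" using c by simp
      then have n: "u \<le> real n" using uV by linarith
      then have "1 \<le> real n / u" using u by simp
      from g_decay[OF this] have "\<bar>g (real n / u)\<bar> / real n \<le> A / (real n / u) / real n"
        unfolding A_def by (rule divide_right_mono) simp
      also have "\<dots> = A * u * real n powr (-1 - 1)"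
        using n u by (simp add: powr_minus powr_numeral field_simps power2_eq_square)
      finally show "\<bar>?f n\<bar> \<le> A * u * real n powr (-1 - 1)" by simp
    qed
    also have "\<dots> \<le> A * u * (real (c + 1) powr (-1) * (1 / real (c + 1) + 1 / 1))"
      unfolding sum_distrib_left[symmetric] using AB u sum_powr_le[OF _ c1, of 1 d]
      by (intro mult_left_mono) auto
    also have "\<dots> \<le> A * u * (1 / (u * V) * (1 + 1 / 1))"
    proof (intro mult_left_mono mult_mono add_mono)
      have "0 < u * V" using u V by (intro mult_pos_pos) auto
      then show "real (c + 1) powr (-1) \<le> 1 / (u * V)"
        using c by (simp add: powr_minus_divide frac_le)
    qed (use AB u V in auto)
    also have "\<dots> = 2 * A / V" using u by simp
    finally show ?thesis .
  qed
  have e3: "\<bar>integral {V..W} (\<lambda>w. g w / w)\<bar> \<le> A / V"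
  proof -
    have "\<bar>integral {V..W} (\<lambda>w. g w / w)\<bar> \<le> A * V powr (-1) / 1"
    proof (rule abs_integral_le_powr)
      fix w assume w: "w \<in> {V..W}"
      then have w1: "1 \<le> w" using V by auto
      have "\<bar>g w\<bar> / w \<le> A / w / w" using g_decay[OF w1] w1 unfolding A_def by (intro divide_right_mono) auto
      then have "\<bar>g w / w\<bar> \<le> A / w / w" using w1 by simp
      also have "\<dots> = A * w powr (-1 - 1)"
        using w1 by (simp add: powr_minus powr_numeral field_simps power2_eq_square)
      finally show "\<bar>g w / w\<bar> \<le> A * w powr (-1 - 1)" .
    qed (use V in \<open>auto intro: integrable_g_over\<close>)
    then show ?thesis using V by (simp add: powr_minus_divide)
  qed
  have "\<bar>(\<Sum>n = a..d. ?f n) - integral {1..W} (\<lambda>w. g w / w)\<bar> \<le> 3 * B / V + 2 * A / V + A / V"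
    unfolding split isplit using e1 e2 e3 by linarith
  also have "\<dots> = 3 * (A + B) / V" using V by (simp add: add_divide_distrib)
  finally have "\<bar>dtrunc W u\<bar> \<le> R * (3 * (A + B) / V)"
    unfolding dtrunc_def abs_mult a_def[symmetric] d_def[symmetric] by (rule mult_left_mono) simp
  also have "\<dots> = R * (3 * (A + B)) * (1 / V)" by simp
  \<comment> \<open>Brings the bound to the shape \<open>P * R ^ 5\<close> that
    \<open>interpolated_decay\<close> expects; the constant 5 is below \<open>R ^ 3\<close>.\<close>
  also have "\<dots> \<le> B * R ^ 5 * (1 / V)"
  proof (intro mult_right_mono)
    define q where "q = R * B"
    have "A = 91/90 * q" by (simp add: q_def A_def B_def power2_eq_square power3_eq_cube)
    moreover have "2 * B \<le> q" unfolding q_def using lam_ge AB by (intro mult_right_mono) auto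
    ultimately have "3 * (A + B) \<le> 5 * (R * B)"
      using AB unfolding q_def[symmetric] by simp
    then have "R * (3 * (A + B)) \<le> R * (5 * (R * B))" by (intro mult_left_mono) auto
    also have "\<dots> = 5 * R\<^sup>2 * B" by (simp add: power2_eq_square)
    also have "\<dots> \<le> (R ^ 3 * R\<^sup>2) * B"
      using power_mono[OF lam_ge, of 3] AB by (intro mult_right_mono) auto
    also have "\<dots> = B * R ^ 5" by (simp only: power_add[symmetric] mult.commute[of B]) simp
    finally show "R * (3 * (A + B)) \<le> B * R ^ 5" .
  qed (use V in auto)
  also have "1 / V = u powr (-1/2)" using u by (simp add: V_def powr_minus_divide powr_half_sqrt)
  finally show ?thesis by (simp add: B_def)
qed

text \<open>Interpolates between the Lipschitz bound and \<open>dtrunc_decay_half\<close>, with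
  \<open>P\<close> proportional to \<open>t - s\<close>.\<close>

lemma g_lipschitz_eta:
  assumes st: "1 \<le> s" "s \<le> t"
  shows "\<bar>g t - g s\<bar> \<le> 180 * (R\<^sup>2 * L) * s powr (-\<eta>) * (t - s)"
proof -
  let ?P = "90 * (R\<^sup>2 * L) * (t - s)"
  have "\<bar>g t - g s\<bar> \<le> 2 * ?P * s powr (-\<eta>)"
  proof (rule interpolated_decay[OF lam_ge st(1)])
    show "\<bar>g t - g s\<bar> \<le> ?P" using st by (rule g_lipschitz)
    have "\<bar>g t - g s\<bar> \<le> 90 * (R\<^sup>2 * L) * R ^ 5 * s powr (-1/2) * (t - s)"
    proof (rule g_increment_le[where ?W0.0 = "sqrt t", OF st])
      fix W u assume W: "sqrt t \<le> W" and u: "u \<in> {s..t}"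
      have "sqrt u \<le> W" using u W by (intro order.trans[OF real_sqrt_le_mono W]) auto
      then have "\<bar>dtrunc W u\<bar> \<le> 90 * (R\<^sup>2 * L) * R ^ 5 * u powr (-1/2)"
        using u st by (intro dtrunc_decay_half) auto
      also have "\<dots> \<le> 90 * (R\<^sup>2 * L) * R ^ 5 * s powr (-1/2)"
        using u st L_ge by (intro mult_left_mono powr_mono2') auto
      finally show "\<bar>dtrunc W u\<bar> \<le> 90 * (R\<^sup>2 * L) * R ^ 5 * s powr (-1/2)" .
    qed
    then show "\<bar>g t - g s\<bar> \<le> ?P * R ^ 5 * s powr (-1/2)" by (simp only: mult_ac)
  qed (use st R2L_nonneg in auto)
  then show ?thesis by (simp add: mult_ac)
qed

text \<open>The quadrature error again, now with local Lipschitz constants decaying like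
  \<open>s powr (-\<eta>)\<close>. Their weighted sum is bounded by \<open>1 + 1 / \<eta>\<close>,
  which explains the second factor \<open>L\<close> and leaves the full gain
  \<open>1 / u\<close>.\<close>

lemma dtrunc_decay:
  assumes W: "1 \<le> W" and u: "1 \<le> u"
  shows "\<bar>dtrunc W u\<bar> \<le> 3900 * (R ^ 3 * L\<^sup>2) / u"
proof -
  define B where "B = R\<^sup>2 * L"
  have B: "0 \<le> B" "R \<le> 3/4 * B" using R2L_nonneg R_le by (auto simp: B_def)
  let ?I = "{nat \<lceil>u\<rceil>..nat \<lfloor>u * W\<rfloor>}"
  have "\<bar>(\<Sum>n \<in> ?I. g (real n / u) / real n) - integral {1..W} (\<lambda>w. g w / w)\<bar>
      \<le> (3/2 * R + (\<Sum>n \<in> ?I. (180 * B * (real n / u) powr (-\<eta>) + R / 2 * (u / real n)) / real n)) / u"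
    using g_lipschitz_eta B by (intro euler_maclaurin_g u W) (auto simp only: B_def intro!: mult_nonneg_nonneg powr_ge_zero)
  also have "\<dots> \<le> (9/8 * B + (\<Sum>n \<in> ?I. 181 * B * ((real n / u) powr (-\<eta>) / real n))) / u"
  proof (intro divide_right_mono add_mono sum_mono)
    show "3/2 * R \<le> 9/8 * B" using B by simp
    fix n assume "n \<in> ?I"
    then have n: "u \<le> real n" by (simp add: nat_le_iff ceiling_le_iff)
    then have nu: "1 \<le> real n / u" using u by simp
    have "u / real n = (real n / u) powr (-1)" using u n by (simp add: powr_minus_divide)
    also have "\<dots> \<le> (real n / u) powr (-\<eta>)" using nu L_ge by (intro powr_mono) (auto simp: field_simps)
    finally have "R / 2 * (u / real n) \<le> B * (real n / u) powr (-\<eta>)" using B u by (intro mult_mono) auto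
    then have "180 * B * (real n / u) powr (-\<eta>) + R / 2 * (u / real n) \<le> 181 * B * (real n / u) powr (-\<eta>)"
      by simp
    then show "(180 * B * (real n / u) powr (-\<eta>) + R / 2 * (u / real n)) / real n
        \<le> 181 * B * ((real n / u) powr (-\<eta>) / real n)"
      unfolding times_divide_eq_right by (rule divide_right_mono) simp
  qed (use u in auto)
  also have "\<dots> \<le> (9/8 * B + 181 * B * (1 + 1 / \<eta>)) / u"
    unfolding sum_distrib_left[symmetric] using sum_scaled_powr_le[OF eta_pos u] B u
    by (intro divide_right_mono add_left_mono mult_left_mono) auto
  also have "\<dots> = (183 * B - 7/8 * B + 3620 * (B * L)) / u" by (simp add: algebra_simps)
  also have "\<dots> \<le> 3900 * (B * L) / u"
  proof (intro divide_right_mono)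
    \<comment> \<open>Since \<open>B\<close> is at most 3/2 of \<open>B * L\<close>, the terms
      without \<open>L\<close> add less than 280 to 3620.\<close>
    have "B * (2/3) \<le> B * L" using B L_ge by (intro mult_left_mono) auto
    then show "183 * B - 7/8 * B + 3620 * (B * L) \<le> 3900 * (B * L)" using B by linarith
  qed (use u in auto)
  finally have "\<bar>dtrunc W u\<bar> \<le> R * (3900 * (B * L) / u)"
    unfolding dtrunc_def abs_mult by (rule mult_left_mono) simp
  then show ?thesis by (simp add: B_def power2_eq_square power3_eq_cube mult_ac)
qed

lemma g_increment_decay:
  assumes st: "1 \<le> s" "s \<le> t"
  shows "\<bar>g t - g s\<bar> \<le> 3900 * (R ^ 3 * L\<^sup>2) / s * (t - s)"
proof (rule g_increment_le[where ?W0.0 = 1, OF st])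
  fix W u :: real assume W: "1 \<le> W" and u: "u \<in> {s..t}"
  have "\<bar>dtrunc W u\<bar> \<le> 3900 * (R ^ 3 * L\<^sup>2) / u" using W u st by (intro dtrunc_decay) auto
  also have "\<dots> \<le> 3900 * (R ^ 3 * L\<^sup>2) / s" using u st by (intro divide_left_mono) auto
  finally show "\<bar>dtrunc W u\<bar> \<le> 3900 * (R ^ 3 * L\<^sup>2) / s" .
qed

end

subsection \<open>The Bernoulli expansion\<close>

lemma continuous_on_B2 [continuous_intros]:
  "continuous_on S f \<Longrightarrow> continuous_on S (\<lambda>x. B2 (f x))"
  using continuous_on_compose2[of UNIV B2 S f] isCont_B2
  by (auto intro: continuous_at_imp_continuous_on)

lemma B2_oscillatory_bound:
  assumes x: "0 < x" "x \<le> 1" and p: "1 \<le> p" "p \<le> q" and f: "continuous_on {p..q} f"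
    and D: "\<And>u. u \<in> {p..q} \<Longrightarrow> \<bar>f u\<bar> \<le> D"
    and E: "\<And>s t. p \<le> s \<Longrightarrow> s \<le> t \<Longrightarrow> t \<le> s + x \<Longrightarrow> t \<le> q \<Longrightarrow> \<bar>f t - f s\<bar> \<le> E / s\<^sup>2"
  shows "\<bar>integral {p..q} (\<lambda>u. B2 (u / x) * f u)\<bar> \<le> D * x / 2 + E"
proof (rule oscillatory_integral_bound[OF B2_measurable _ B2_mean_zero x p f D E])
  show "\<bar>B2 t\<bar> \<le> 1/2" for t using abs_B2_le[of t] by simp
qed (use x in auto)

context saw_eigenfunction
begin

text \<open>As a function of \<open>u\<close>, \<open>g (n / u)\<close> varies at a rate bounded
  independently of \<open>n\<close>: the growth of \<open>n / u\<close> is compensated by the decay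
  of the increments of \<open>g\<close>. The condition \<open>q \<le> n\<close> keeps
  \<open>n / u\<close> at least 1.\<close>

lemma B2_term_bound:
  assumes x: "0 < x" "x \<le> 1" and p: "1 \<le> p" "p \<le> q" "q \<le> real n"
  shows "\<bar>integral {p..q} (\<lambda>u. B2 (u / x) * (g (real n / u) / u\<^sup>2))\<bar> \<le> 3902 * (R ^ 3 * L\<^sup>2) * x"
proof -
  define A where "A = R ^ 3 * L\<^sup>2"
  have RA: "R \<le> A"
  proof -
    have "1 \<le> R * L" using mult_mono[OF lam_ge L_ge] by simp
    then have "1 \<le> (R * L)\<^sup>2" by (rule one_le_power)
    then have "1 \<le> R\<^sup>2 * L\<^sup>2" by (simp only: power_mult_distrib)
    then have "R * 1 \<le> R * (R\<^sup>2 * L\<^sup>2)" by (intro mult_left_mono) auto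
    then show ?thesis by (simp add: A_def power2_eq_square power3_eq_cube mult_ac)
  qed
  have "\<bar>integral {p..q} (\<lambda>u. B2 (u / x) * (g (real n / u) / u\<^sup>2))\<bar> \<le> R / 2 * x / 2 + (3900 * A + R) * x"
  proof (rule B2_oscillatory_bound[OF x p(1,2)])
    show "continuous_on {p..q} (\<lambda>u. g (real n / u) / u\<^sup>2)" using p by (auto intro!: continuous_intros)
    show "\<bar>g (real n / u) / u\<^sup>2\<bar> \<le> R / 2" if "u \<in> {p..q}" for u
      using g_le[of "real n / u"] that p frac_le[of "R / 2" "\<bar>g (real n / u)\<bar>" 1 "u\<^sup>2"] by (auto simp: one_le_power)
    fix s t assume st: "p \<le> s" "s \<le> t" "t \<le> s + x" "t \<le> q"
    have s1: "1 \<le> s" and t0: "0 < t" using st p by auto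
    have "\<bar>g (real n / s) - g (real n / t)\<bar> \<le> 3900 * A / (real n / t) * (real n / s - real n / t)"
      unfolding A_def using st p s1 t0 by (intro g_increment_decay) (auto simp: divide_left_mono)
    \<comment> \<open>The factor \<open>n\<close> cancels here.\<close>
    also have "\<dots> = 3900 * A * ((t - s) / s)" using s1 t0 st p by (simp add: field_simps)
    also have "\<dots> \<le> 3900 * A * x"
    proof (intro mult_left_mono)
      have "(t - s) / s \<le> (t - s) / 1" using s1 st by (intro divide_left_mono) auto
      then show "(t - s) / s \<le> x" using st by simp
    qed (use RA in auto)
    finally have inc: "\<bar>g (real n / t) - g (real n / s)\<bar> \<le> 3900 * A * x" by (simp add: abs_minus_commute)
    have "\<bar>g (real n / t) / t\<^sup>2 - g (real n / s) / s\<^sup>2\<bar>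
        \<le> (\<bar>g (real n / t) - g (real n / s)\<bar> + \<bar>g (real n / s)\<bar> * real 2 * (t - s) / s) / s\<^sup>2"
      using s1 st by (intro abs_divide_power_diff_le)
    also have "\<dots> \<le> (3900 * A * x + R / 2 * real 2 * x / 1) / s\<^sup>2"
      using st s1 x by (intro divide_right_mono add_mono inc frac_le mult_mono g_le) auto
    also have "\<dots> = (3900 * A + R) * x / s\<^sup>2" by (simp add: algebra_simps)
    finally show "\<bar>g (real n / t) / t\<^sup>2 - g (real n / s) / s\<^sup>2\<bar> \<le> (3900 * A + R) * x / s\<^sup>2" .
  qed
  also have "\<dots> = (3900 * A + 5/4 * R) * x" by (simp add: algebra_simps)
  also have "\<dots> \<le> 3902 * A * x" using RA x by (intro mult_right_mono) linarith+
  finally show ?thesis by (simp add: A_def)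
qed

text \<open>Only \<open>n \<le> 1 / x\<^sup>2\<close> contributes, and each such \<open>n\<close> contributes \<open>O (x / n)\<close>: this is where the
  factor \<open>1 + ln (1 / x)\<close> comes from.\<close>

lemma B2_dtrunc_integral:
  assumes x: "0 < x" "x \<le> 1"
  shows "(\<lambda>u. B2 (u / x) * (dtrunc (1 / x) u / u\<^sup>2)) integrable_on {1..1 / x}"
    and "\<bar>integral {1..1 / x} (\<lambda>u. B2 (u / x) * (dtrunc (1 / x) u / u\<^sup>2))\<bar>
      \<le> R * (7804 * (R ^ 3 * L\<^sup>2) * x * (1 + ln (1 / x)) + 100 * R * L * x)"
proof -
  define W where "W = 1 / x"
  \<comment> \<open>For \<open>u \<le> W\<close> the nodes satisfy \<open>n \<le> u * W\<close>, so
    indices up to \<open>W * W = 1 / x^2\<close> suffice.\<close>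
  define N where "N = nat \<lceil>W * W\<rceil>"
  define c where "c = integral {1..W} (\<lambda>w. g w / w)"
  have W: "1 \<le> W" using x by (simp add: W_def)
  have WW: "1 \<le> W * W" using mult_mono[of 1 W 1 W] W by simp
  have N: "W * W \<le> real N" "real N < W * W + 1" "1 \<le> N" unfolding N_def using WW by linarith+
  let ?p = "\<lambda>n::nat. max 1 (real n / W)" and ?q = "\<lambda>n::nat. min W (real n)"
  let ?h = "\<lambda>n u. B2 (u / x) * (g (real n / u) / u\<^sup>2)"
  define T where "T n = integral {?p n..?q n} (?h n)" for n
  have summand: "((\<lambda>u. B2 (u / x) * ((if u \<le> real n \<and> real n \<le> u * W then g (real n / u) / real n else 0) / u\<^sup>2))
      has_integral T n / real n) {1..W}" for n
  proof -
    have "(?h n has_integral T n) {?p n..?q n}"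
      unfolding T_def using x
      by (intro integrable_integral integrable_continuous_interval) (auto intro!: continuous_intros)
    then have "((\<lambda>u. ?h n u / real n) has_integral T n / real n) {?p n..?q n}"
      by (rule has_integral_divide)
    then have "((\<lambda>u. if u \<in> {?p n..?q n} then ?h n u / real n else 0) has_integral T n / real n) {1..W}"
      by (subst has_integral_restrict) auto
    then show ?thesis
    proof (rule has_integral_eq[rotated])
      fix u assume u: "u \<in> {1..W}"
      \<comment> \<open>For fixed \<open>n\<close> the indicator in the sum cuts out an interval of
        \<open>u\<close>, which turns each summand into one oscillatory integral.\<close>
      have "u \<in> {?p n..?q n} \<longleftrightarrow> u \<le> real n \<and> real n \<le> u * W"
        using u W by (auto simp: field_simps)
      then show "(if u \<in> {?p n..?q n} then ?h n u / real n else 0)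
        = B2 (u / x) * ((if u \<le> real n \<and> real n \<le> u * W then g (real n / u) / real n else 0) / u\<^sup>2)"
        by auto
    qed
  qed
  define J where "J = integral {1..W} (\<lambda>u. B2 (u / x) * (1 / u\<^sup>2))"
  have Jint: "((\<lambda>u. B2 (u / x) * (1 / u\<^sup>2)) has_integral J) {1..W}"
    unfolding J_def using x
    by (intro integrable_integral integrable_continuous_interval) (auto intro!: continuous_intros)
  have "((\<lambda>u. lam * ((\<Sum>n = 1..N. B2 (u / x) * ((if u \<le> real n \<and> real n \<le> u * W then g (real n / u) / real n else 0) / u\<^sup>2))
      - c * (B2 (u / x) * (1 / u\<^sup>2)))) has_integral lam * ((\<Sum>n = 1..N. T n / real n) - c * J)) {1..W}"
    by (intro has_integral_mult_right has_integral_diff has_integral_sum summand Jint) auto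
  then have main: "((\<lambda>u. B2 (u / x) * (dtrunc W u / u\<^sup>2)) has_integral lam * ((\<Sum>n = 1..N. T n / real n) - c * J)) {1..W}"
  proof (rule has_integral_eq[rotated])
    fix u assume u: "u \<in> {1..W}"
    have "u * W \<le> W * W" using u W by (intro mult_right_mono) auto
    then have "dtrunc W u = lam * ((\<Sum>n = 1..N. if u \<le> real n \<and> real n \<le> u * W then g (real n / u) / real n else 0) - c)"
      unfolding c_def using u W by (intro dtrunc_indicator order.trans[OF _ N(1)]) auto
    then show "lam * ((\<Sum>n = 1..N. B2 (u / x) * ((if u \<le> real n \<and> real n \<le> u * W then g (real n / u) / real n else 0) / u\<^sup>2))
      - c * (B2 (u / x) * (1 / u\<^sup>2))) = B2 (u / x) * (dtrunc W u / u\<^sup>2)"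
      by (simp add: sum_distrib_left[symmetric] sum_divide_distrib[symmetric] diff_divide_distrib right_diff_distrib mult_ac)
  qed
  show "(\<lambda>u. B2 (u / x) * (dtrunc (1 / x) u / u\<^sup>2)) integrable_on {1..1 / x}"
    using main unfolding W_def by blast
  \<comment> \<open>\<open>N\<close> is at most \<open>2 * W^2\<close>, and
    \<open>ln 2 \<le> 1\<close> is absorbed on doubling.\<close>
  have ell: "1 + ln (real N) \<le> 2 * (1 + ln (1 / x))"
  proof -
    have "real N \<le> 2 * (W * W)" using N WW by linarith
    then have "ln (real N) \<le> ln (2 * (W * W))" using N by (intro ln_mono) auto
    also have "\<dots> = ln 2 + 2 * ln W" using W by (simp add: ln_mult)
    finally show ?thesis using ln_le_minus_one[of 2] by (simp add: W_def)
  qed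
  have Tn: "\<bar>T n\<bar> \<le> 3902 * (R ^ 3 * L\<^sup>2) * x" for n
  proof (cases "?p n \<le> ?q n")
    case True
    then show ?thesis unfolding T_def using x by (intro B2_term_bound) auto
  next
    case False
    then show ?thesis unfolding T_def using x by simp
  qed
  have "\<bar>\<Sum>n = 1..N. T n / real n\<bar> \<le> (\<Sum>n = 1..N. 3902 * (R ^ 3 * L\<^sup>2) * x * (1 / real n))"
  proof (intro order.trans[OF sum_abs] sum_mono)
    fix n show "\<bar>T n / real n\<bar> \<le> 3902 * (R ^ 3 * L\<^sup>2) * x * (1 / real n)"
      using divide_right_mono[OF Tn[of n], of "real n"] by simp
  qed
  also have "\<dots> \<le> 3902 * (R ^ 3 * L\<^sup>2) * x * (1 + ln (real N))"
    unfolding sum_distrib_left[symmetric] using sum_inverse_le_ln[of 1 "real N"] N x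
    by (intro mult_left_mono) auto
  also have "\<dots> \<le> 3902 * (R ^ 3 * L\<^sup>2) * x * (2 * (1 + ln (1 / x)))"
    using ell x by (intro mult_left_mono) auto
  also have "\<dots> = 7804 * (R ^ 3 * L\<^sup>2) * x * (1 + ln (1 / x))" by simp
  finally have sum_le: "\<bar>\<Sum>n = 1..N. T n / real n\<bar> \<le> 7804 * (R ^ 3 * L\<^sup>2) * x * (1 + ln (1 / x))" .
  have J_le: "\<bar>J\<bar> \<le> 1 * x / 2 + 2 * x"
    unfolding J_def
  proof (rule B2_oscillatory_bound[OF x _ W])
    show "continuous_on {1..W} (\<lambda>u. 1 / u\<^sup>2 :: real)" by (auto intro!: continuous_intros)
    show "\<bar>1 / u\<^sup>2\<bar> \<le> 1" if "u \<in> {1..W}" for u :: real using that by (auto simp: one_le_power)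
    fix s t assume st: "1 \<le> s" "s \<le> t" "t \<le> s + x"
    have "\<bar>1 / t\<^sup>2 - 1 / s\<^sup>2\<bar> \<le> (\<bar>1 - 1\<bar> + \<bar>1\<bar> * real 2 * (t - s) / s) / s\<^sup>2"
      using abs_divide_power_diff_le[OF st(1,2), of "\<lambda>_. 1" 2] by simp
    also have "\<dots> \<le> (0 + 1 * real 2 * x / 1) / s\<^sup>2"
      using st x by (intro divide_right_mono add_mono frac_le mult_mono) auto
    finally show "\<bar>1 / t\<^sup>2 - 1 / s\<^sup>2\<bar> \<le> 2 * x / s\<^sup>2" by simp
  qed auto
  have "\<bar>c * J\<bar> \<le> (40 * R * L) * (1 * x / 2 + 2 * x)"
    unfolding abs_mult c_def using abs_integral_g_over_le[OF W] J_le L_ge by (intro mult_mono) auto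
  then have cJ: "\<bar>c * J\<bar> \<le> 100 * R * L * x" by (simp add: mult_ac)
  have "\<bar>lam * ((\<Sum>n = 1..N. T n / real n) - c * J)\<bar>
      \<le> R * (7804 * (R ^ 3 * L\<^sup>2) * x * (1 + ln (1 / x)) + 100 * R * L * x)"
    unfolding abs_mult[of lam] using sum_le cJ by (intro mult_left_mono) linarith+
  then show "\<bar>integral {1..1 / x} (\<lambda>u. B2 (u / x) * (dtrunc (1 / x) u / u\<^sup>2))\<bar>
      \<le> R * (7804 * (R ^ 3 * L\<^sup>2) * x * (1 + ln (1 / x)) + 100 * R * L * x)"
    using integral_unique[OF main] by (simp add: W_def)
qed

section \<open>Truncation at 1/x, integration by parts, and the asymptotic formula\<close>

lemma trunc_error_inverse:
  assumes x: "0 < x" "x \<le> 1" and v: "1 \<le> v"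
  shows "\<bar>g v - trunc (1 / x) v\<bar> \<le> 46 * (R ^ 4 * L) * x\<^sup>2"
proof -
  have "\<bar>g v - trunc (1 / x) v\<bar> \<le> R * (91 * (R ^ 3 * L) / 2 * (1 / x) powr (-1 - 1))"
  proof (intro trunc_error v)
    fix w assume "1 / x \<le> w"
    moreover have "1 \<le> 1 / x" using x by simp
    ultimately have w: "1 \<le> w" by linarith
    show "\<bar>g w\<bar> \<le> 91 * (R ^ 3 * L) * w powr (-1)"
      using g_decay[OF w] w by (simp add: powr_minus_divide)
  qed (use x in auto)
  also have "\<dots> = 91/2 * (R ^ 4 * L) * x\<^sup>2"
    using x by (simp add: powr_minus powr_numeral power_divide field_simps eval_nat_numeral)
  also have "\<dots> \<le> 46 * (R ^ 4 * L) * x\<^sup>2" using L_ge by (intro mult_right_mono) auto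
  finally show ?thesis .
qed

text \<open>\<open>trunc\<close> is replaced by \<open>g\<close>, whose size and Lipschitz constant
  are known, at a cost integrable against \<open>1 / u^2\<close>;
  \<open>B2_oscillatory_bound\<close> handles the rest.\<close>

lemma B2_trunc_integral:
  assumes x: "0 < x" "x \<le> 1"
  shows "\<bar>integral {1..1 / x} (\<lambda>u. B2 (u / x) * (trunc (1 / x) u / u ^ 3))\<bar>
      \<le> 46 * (R ^ 4 * L) * x\<^sup>2 + 92 * (R\<^sup>2 * L) * x"
proof -
  define W where "W = 1 / x"
  define e where "e = 46 * (R ^ 4 * L) * x\<^sup>2"
  have W: "1 \<le> W" using x by (simp add: W_def)
  have e0: "0 \<le> e" using L_ge by (simp add: e_def)
  have c1: "(\<lambda>u. B2 (u / x) * (g u / u ^ 3)) integrable_on {1..W}"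
    using x by (intro integrable_continuous_interval) (auto intro!: continuous_intros)
  have c2: "(\<lambda>u. B2 (u / x) * (trunc W u / u ^ 3)) integrable_on {1..W}"
    using x by (intro integrable_continuous_interval) (auto intro!: continuous_intros continuous_on_trunc[OF W])
  have "\<bar>integral {1..W} (\<lambda>u. B2 (u / x) * (g u / u ^ 3))\<bar> \<le> R / 2 * x / 2 + (90 * (R\<^sup>2 * L) + 3/2 * R) * x"
  proof (rule B2_oscillatory_bound[OF x _ W])
    show "continuous_on {1..W} (\<lambda>u. g u / u ^ 3)" by (auto intro!: continuous_intros)
    show "\<bar>g u / u ^ 3\<bar> \<le> R / 2" if "u \<in> {1..W}" for u
      using g_le[of u] that frac_le[of "R / 2" "\<bar>g u\<bar>" 1 "u ^ 3"] by (auto simp: one_le_power)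
    fix s t assume st: "1 \<le> s" "s \<le> t" "t \<le> s + x"
    have inc: "\<bar>g t - g s\<bar> \<le> 90 * (R\<^sup>2 * L) * x"
      using g_lipschitz[OF st(1,2)] st R2L_nonneg mult_left_mono[of "t - s" x "90 * (R\<^sup>2 * L)"] by linarith
    have "\<bar>g t / t ^ 3 - g s / s ^ 3\<bar> \<le> (\<bar>g t - g s\<bar> + \<bar>g s\<bar> * real 3 * (t - s) / s) / s ^ 3"
      using st by (intro abs_divide_power_diff_le)
    also have "\<dots> \<le> (90 * (R\<^sup>2 * L) * x + R / 2 * real 3 * x / 1) / s\<^sup>2"
    proof (intro frac_le add_mono inc mult_mono g_le)
      show "s\<^sup>2 \<le> s ^ 3" using st by (intro power_increasing) auto
    qed (use st x L_ge in auto)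
    also have "\<dots> = (90 * (R\<^sup>2 * L) + 3/2 * R) * x / s\<^sup>2" by (simp add: algebra_simps)
    finally show "\<bar>g t / t ^ 3 - g s / s ^ 3\<bar> \<le> (90 * (R\<^sup>2 * L) + 3/2 * R) * x / s\<^sup>2" .
  qed auto
  also have "\<dots> = (90 * (R\<^sup>2 * L) + 7/4 * R) * x" by (simp add: algebra_simps)
  also have "\<dots> \<le> 92 * (R\<^sup>2 * L) * x" using R_le R2L_nonneg x by (intro mult_right_mono) linarith+
  finally have 1: "\<bar>integral {1..W} (\<lambda>u. B2 (u / x) * (g u / u ^ 3))\<bar> \<le> 92 * (R\<^sup>2 * L) * x" .
  have "\<bar>integral {1..W} (\<lambda>u. B2 (u / x) * (trunc W u / u ^ 3) - B2 (u / x) * (g u / u ^ 3))\<bar>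
      \<le> e * 1 powr (-1) / 1"
  proof (intro abs_integral_le_powr integrable_diff c1 c2 W)
    fix u assume u: "u \<in> {1..W}"
    have "\<bar>B2 (u / x) * (trunc W u / u ^ 3) - B2 (u / x) * (g u / u ^ 3)\<bar>
        = \<bar>B2 (u / x)\<bar> * (\<bar>g u - trunc W u\<bar> / u ^ 3)"
      using u by (simp add: abs_mult[symmetric] abs_minus_commute right_diff_distrib[symmetric] diff_divide_distrib[symmetric] flip: abs_divide)
         (simp add: abs_mult abs_minus_commute)
    also have "\<dots> \<le> 1 * (e / u\<^sup>2)"
    proof (intro mult_mono frac_le)
      show "\<bar>B2 (u / x)\<bar> \<le> 1" using abs_B2_le[of "u / x"] by simp
      show "\<bar>g u - trunc W u\<bar> \<le> e" unfolding W_def e_def using x u by (intro trunc_error_inverse) auto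
      show "u\<^sup>2 \<le> u ^ 3" using u by (intro power_increasing) auto
    qed (use u e0 in auto)
    also have "\<dots> = e * u powr (-1 - 1)" using u by (simp add: powr_minus powr_numeral field_simps)
    finally show "\<bar>B2 (u / x) * (trunc W u / u ^ 3) - B2 (u / x) * (g u / u ^ 3)\<bar> \<le> e * u powr (-1 - 1)" .
  qed auto
  then have "\<bar>integral {1..W} (\<lambda>u. B2 (u / x) * (trunc W u / u ^ 3)) - integral {1..W} (\<lambda>u. B2 (u / x) * (g u / u ^ 3))\<bar> \<le> e"
    using integral_diff[OF c2 c1] by simp
  with 1 show ?thesis unfolding W_def[symmetric] e_def[symmetric] by linarith
qed


text \<open>Parts are taken with \<open>trunc W\<close> rather than \<open>g\<close> because its
  derivative is explicit off a finite set. The boundary term at 1 is the source of the main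
  term.\<close>

lemma trunc_by_parts:
  assumes x: "0 < x" "x \<le> 1" and W: "1 \<le> W"
    and dint: "(\<lambda>u. B2 (u / x) * (dtrunc W u / u\<^sup>2)) integrable_on {1..W}"
  shows "((\<lambda>u. saw (u / x) * (trunc W u / u\<^sup>2)) has_integral
      (x / 2 * B2 (1 / x) * trunc W 1 - x / 2 * B2 (W / x) * (trunc W W / W\<^sup>2)
       + x / 2 * integral {1..W} (\<lambda>u. B2 (u / x) * (dtrunc W u / u\<^sup>2))
       - x * integral {1..W} (\<lambda>u. B2 (u / x) * (trunc W u / u ^ 3)))) {1..W}"
proof -
  define N where "N = nat \<lceil>W * W\<rceil>"
  have N: "W * W \<le> real N" unfolding N_def by (rule real_nat_ceiling_ge)
  define H where "H u = - (x / 2) * (B2 (u / x) * (trunc W u / u\<^sup>2))" for u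
  \<comment> \<open>Jumps of the sawtooth together with kinks of the truncation.\<close>
  let ?S = "{u \<in> {1..W}. u / x \<in> \<int>} \<union> kinks W N"
  have tint: "(\<lambda>u. B2 (u / x) * (trunc W u / u ^ 3)) integrable_on {1..W}"
    using x by (intro integrable_continuous_interval) (auto intro!: continuous_intros continuous_on_trunc[OF W])
  have "((\<lambda>u. saw (u / x) * (trunc W u / u\<^sup>2) - x / 2 * (B2 (u / x) * (dtrunc W u / u\<^sup>2))
      + x * (B2 (u / x) * (trunc W u / u ^ 3))) has_integral (H W - H 1)) {1..W}"
  proof (rule fundamental_theorem_of_calculus_interior_strong[of ?S])
    show "finite ?S" using finite_scaled_Ints[OF x(1)] finite_kinks by simp
    show "continuous_on {1..W} H"
      unfolding H_def using x by (auto intro!: continuous_intros continuous_on_trunc[OF W])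
    fix u assume u: "u \<in> {1<..<W} - ?S"
    then have u0: "u \<noteq> 0" "u / x \<notin> \<int>" by auto
    have "(B2 has_real_derivative - 2 * saw (u / x)) (at (u / x))"
      using u0 by (intro DERIV_B2)
    then have dB: "((\<lambda>u. B2 (u / x)) has_real_derivative - 2 * saw (u / x) * (1 / x)) (at u)"
      by (rule DERIV_chain2) (use x in \<open>auto intro!: derivative_eq_intros\<close>)
    have dt: "(trunc W has_real_derivative dtrunc W u) (at u)"
      using u W N by (intro DERIV_trunc[where U = W and N = N]) auto
    have dq: "((\<lambda>u. trunc W u / u\<^sup>2) has_real_derivative
        (dtrunc W u * u\<^sup>2 - trunc W u * (2 * u)) / (u\<^sup>2 * u\<^sup>2)) (at u)"
      using u0 by (intro DERIV_divide dt) (auto intro!: derivative_eq_intros)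
    have "(H has_real_derivative - (x / 2) * (- 2 * saw (u / x) * (1 / x) * (trunc W u / u\<^sup>2)
        + (dtrunc W u * u\<^sup>2 - trunc W u * (2 * u)) / (u\<^sup>2 * u\<^sup>2) * B2 (u / x))) (at u)"
      unfolding H_def by (intro DERIV_cmult DERIV_mult dB dq)
    also have "- (x / 2) * (- 2 * saw (u / x) * (1 / x) * (trunc W u / u\<^sup>2)
        + (dtrunc W u * u\<^sup>2 - trunc W u * (2 * u)) / (u\<^sup>2 * u\<^sup>2) * B2 (u / x))
      = saw (u / x) * (trunc W u / u\<^sup>2) - x / 2 * (B2 (u / x) * (dtrunc W u / u\<^sup>2))
      + x * (B2 (u / x) * (trunc W u / u ^ 3))"
    proof -
      have "(dtrunc W u * u\<^sup>2 - trunc W u * (2 * u)) / (u\<^sup>2 * u\<^sup>2) = dtrunc W u / u\<^sup>2 - 2 * (trunc W u / u ^ 3)"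
        using u0 by (simp add: field_simps eval_nat_numeral)
      moreover have "- (x / 2) * (- 2 * saw (u / x) * (1 / x) * (trunc W u / u\<^sup>2)) = saw (u / x) * (trunc W u / u\<^sup>2)"
        using x by simp
      ultimately show ?thesis by (simp only: distrib_left) (simp add: algebra_simps)
    qed
    finally show "(H has_vector_derivative saw (u / x) * (trunc W u / u\<^sup>2) - x / 2 * (B2 (u / x) * (dtrunc W u / u\<^sup>2))
      + x * (B2 (u / x) * (trunc W u / u ^ 3))) (at u)"
      by (simp only: has_real_derivative_iff_has_vector_derivative)
  qed (use W in auto)
  from has_integral_diff[OF has_integral_add[OF this has_integral_mult_right[OF integrable_integral[OF dint], of "x / 2"]]
      has_integral_mult_right[OF integrable_integral[OF tint], of x]]
  show ?thesis by (simp add: H_def mult.assoc)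
qed

text \<open>In the equation at \<open>v = 1 / x\<close> both the integral and the \<open>g\<close>
  inside it are truncated at \<open>W = 1 / x\<close>, each costing a multiple of
  \<open>R ^ 4 * L * x^2\<close>. Integration by parts then leaves the main term, a boundary term at
  \<open>W\<close> and the integrals \<open>J1\<close> and \<open>J2\<close>.\<close>

lemma g_asymptotics:
  assumes x: "0 < x" "x \<le> 1"
  shows "\<bar>g (1 / x) - lam * x / 2 * g 1 * B2 (1 / x)\<bar> \<le> 5000 * (R ^ 5 * L\<^sup>2) * x\<^sup>2 * (1 + ln (1 / x))"
proof -
  define W where "W = 1 / x"
  have W: "1 \<le> W" using x by (simp add: W_def)
  define z l where "z = R ^ 5 * L\<^sup>2" and "l = 1 + ln (1 / x)"
  have l: "1 \<le> l" using x by (simp add: l_def)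
  define e where "e = 46 * (R ^ 4 * L) * x\<^sup>2"
  have R1: "1 \<le> R" using lam_ge by simp
  \<comment> \<open>All lower-order terms are absorbed into \<open>z\<close>, using
    \<open>1 \<le> R\<close> and \<open>L \<le> 3/2 * L^2\<close>.\<close>
  have z1: "R ^ k * L \<le> 3/2 * z" if "k \<le> 5" for k
  proof -
    have "R ^ k * L \<le> R ^ 5 * (3/2 * L\<^sup>2)"
      using that R1 L_ge L_le_square by (intro mult_mono power_increasing) auto
    then show ?thesis by (simp add: z_def)
  qed
  have z2: "R\<^sup>2 \<le> 9/4 * z"
  proof -
    have "R\<^sup>2 * 1 \<le> R\<^sup>2 * (3/2 * L)" using L_ge by (intro mult_left_mono) auto
    then show ?thesis using z1[of 2] by simp
  qed
  have z0: "0 \<le> z" by (simp add: z_def)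
  have e0: "0 \<le> e" using L_ge by (simp add: e_def)
  have e_le: "e \<le> 69 * z * x\<^sup>2"
    unfolding e_def using z1[of 4] by (intro mult_right_mono) (auto simp: mult_ac)
  have Re_le: "R * e \<le> 69 * z * x\<^sup>2"
  proof -
    have "R * e = 46 * (R ^ 5 * L) * x\<^sup>2" by (simp add: e_def eval_nat_numeral)
    also have "\<dots> \<le> 69 * z * x\<^sup>2" using z1[of 5] by (intro mult_right_mono) (auto simp: mult_ac)
    finally show ?thesis .
  qed
  define I IW where "I = integral {1..W} (\<lambda>u. saw (u / x) * (g u / u\<^sup>2))"
    and "IW = integral {1..W} (\<lambda>u. saw (u / x) * (trunc W u / u\<^sup>2))"
  define J1 J2 where "J1 = integral {1..W} (\<lambda>u. B2 (u / x) * (dtrunc W u / u\<^sup>2))"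
    and "J2 = integral {1..W} (\<lambda>u. B2 (u / x) * (trunc W u / u ^ 3))"
  have gI: "\<bar>g (1 / x) - lam * I\<bar> \<le> e"
  proof -
    have "lam * I = trunc W (1 / x)" by (simp add: I_def trunc_def)
    then show ?thesis using trunc_error_inverse[OF x, of "1 / x"] x by (simp add: W_def e_def)
  qed
  have parts: "((\<lambda>u. saw (u / x) * (trunc W u / u\<^sup>2)) has_integral
      (x / 2 * B2 (1 / x) * trunc W 1 - x / 2 * B2 (W / x) * (trunc W W / W\<^sup>2) + x / 2 * J1 - x * J2)) {1..W}"
    unfolding J1_def J2_def using B2_dtrunc_integral(1)[OF x] x W
    by (intro trunc_by_parts) (auto simp: W_def)
  have IW: "IW = x / 2 * B2 (1 / x) * trunc W 1 - x / 2 * B2 (W / x) * (trunc W W / W\<^sup>2) + x / 2 * J1 - x * J2"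
    unfolding IW_def by (rule integral_unique[OF parts])
  \<comment> \<open>The pointwise truncation error \<open>e\<close> is integrated against
    \<open>\<bar>saw\<bar> / u^2\<close>.\<close>
  have I_IW: "\<bar>I - IW\<bar> \<le> e / 2"
  proof -
    have i1: "(\<lambda>u. saw (u / x) * (g u / u\<^sup>2)) integrable_on {1..W}"
      using kernel_integrable_Icc[of 1 "1 / x" W] by simp
    have i2: "(\<lambda>u. saw (u / x) * (trunc W u / u\<^sup>2)) integrable_on {1..W}" using parts by blast
    have "\<bar>integral {1..W} (\<lambda>u. saw (u / x) * (g u / u\<^sup>2) - saw (u / x) * (trunc W u / u\<^sup>2))\<bar> \<le> e / 2 * 1 powr (-1) / 1"
    proof (intro abs_integral_le_powr integrable_diff i1 i2 W)
      fix u assume u: "u \<in> {1..W}"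
      have "\<bar>saw (u / x) * (g u / u\<^sup>2) - saw (u / x) * (trunc W u / u\<^sup>2)\<bar>
          = \<bar>saw (u / x) * ((g u - trunc W u) / u\<^sup>2)\<bar>"
        by (simp add: right_diff_distrib diff_divide_distrib)
      also have "\<dots> = \<bar>saw (u / x)\<bar> * (\<bar>g u - trunc W u\<bar> / u\<^sup>2)" by (simp add: abs_mult)
      also have "\<dots> \<le> 1/2 * (e / u\<^sup>2)"
        unfolding W_def e_def using x u
        by (intro mult_mono divide_right_mono abs_saw_le trunc_error_inverse) auto
      also have "\<dots> = e / 2 * u powr (-1 - 1)" using u by (simp add: powr_minus powr_numeral field_simps)
      finally show "\<bar>saw (u / x) * (g u / u\<^sup>2) - saw (u / x) * (trunc W u / u\<^sup>2)\<bar> \<le> e / 2 * u powr (-1 - 1)" .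
    qed auto
    then show ?thesis using integral_diff[OF i1 i2] by (simp add: I_def IW_def)
  qed
  \<comment> \<open>Restores \<open>g 1\<close> in the boundary term at 1.\<close>
  have b1: "\<bar>x / 2 * B2 (1 / x) * trunc W 1 - x / 2 * B2 (1 / x) * g 1\<bar> \<le> e / 12"
  proof -
    have "\<bar>x / 2 * B2 (1 / x) * trunc W 1 - x / 2 * B2 (1 / x) * g 1\<bar> = x / 2 * \<bar>B2 (1 / x)\<bar> * \<bar>g 1 - trunc W 1\<bar>"
      unfolding right_diff_distrib[symmetric] abs_mult using x by (simp add: abs_minus_commute)
    also have "\<dots> \<le> 1 / 2 * (1/6) * e"
      unfolding W_def e_def using x by (intro mult_mono abs_B2_le trunc_error_inverse) auto
    finally show ?thesis by simp
  qed
  \<comment> \<open>The boundary term at \<open>W\<close> is small because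
    \<open>1 / W^2 = x^2\<close>.\<close>
  have b2: "\<bar>x / 2 * B2 (W / x) * (trunc W W / W\<^sup>2)\<bar> \<le> (R / 2 + e) / 12 * x\<^sup>2"
  proof -
    have "\<bar>trunc W W\<bar> \<le> R / 2 + e"
      using g_le[of W] trunc_error_inverse[OF x W] unfolding W_def[symmetric] e_def[symmetric] by linarith
    then have "\<bar>x / 2 * B2 (W / x) * (trunc W W / W\<^sup>2)\<bar> \<le> 1 / 2 * (1/6) * ((R / 2 + e) / W\<^sup>2)"
      unfolding abs_mult abs_divide using x by (intro mult_mono abs_B2_le) (auto intro!: divide_right_mono)
    also have "\<dots> = (R / 2 + e) / 12 * x\<^sup>2" using x by (simp add: W_def power_divide)
    finally show ?thesis .
  qed
  have J1: "R * \<bar>x / 2 * J1\<bar> \<le> 3902 * z * x\<^sup>2 * l + 75 * z * x\<^sup>2"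
  proof -
    have expand: "r * x / 2 * (r * (7804 * (r ^ 3 * L\<^sup>2) * x * l + 100 * r * L * x))
        = 3902 * (r ^ 5 * L\<^sup>2) * x\<^sup>2 * l + 50 * (r ^ 3 * L) * x\<^sup>2" for r
      by (simp add: eval_nat_numeral algebra_simps)
    have "R * \<bar>x / 2 * J1\<bar> = R * x / 2 * \<bar>J1\<bar>" using x by (simp add: abs_mult)
    also have "\<dots> \<le> R * x / 2 * (R * (7804 * (R ^ 3 * L\<^sup>2) * x * l + 100 * R * L * x))"
      unfolding J1_def l_def W_def using x by (intro mult_left_mono B2_dtrunc_integral(2)) auto
    also have "\<dots> = 3902 * z * x\<^sup>2 * l + 50 * (R ^ 3 * L) * x\<^sup>2"
      unfolding z_def by (rule expand)
    also have "50 * (R ^ 3 * L) * x\<^sup>2 \<le> 75 * z * x\<^sup>2" using z1[of 3] by (intro mult_right_mono) (auto simp: mult_ac)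
    finally show ?thesis by simp
  qed
  have J2: "R * \<bar>x * J2\<bar> \<le> 207 * z * x\<^sup>2"
  proof -
    have "R * \<bar>x * J2\<bar> = R * x * \<bar>J2\<bar>" using x by (simp add: abs_mult)
    also have "\<dots> \<le> R * x * (e + 92 * (R\<^sup>2 * L) * x)"
      unfolding J2_def e_def W_def using x by (intro mult_left_mono B2_trunc_integral) auto
    also have "\<dots> = x * (R * e) + 92 * (R ^ 3 * L) * x\<^sup>2"
      by (simp add: eval_nat_numeral algebra_simps)
    also have "\<dots> \<le> 1 * (R * e) + 138 * z * x\<^sup>2"
      using x e0 z1[of 3] by (intro add_mono mult_right_mono) (auto simp: mult_ac)
    finally show ?thesis using Re_le by linarith
  qed
  define T where "T = lam * x / 2 * g 1 * B2 (1 / x)"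
  have "\<bar>g (1 / x) - T\<bar> \<le> \<bar>g (1 / x) - lam * I\<bar> + \<bar>lam * (I - x / 2 * B2 (1 / x) * g 1)\<bar>"
    unfolding T_def by (simp add: algebra_simps)
  also have "\<dots> \<le> e + R * (e / 2 + e / 12 + (R / 2 + e) / 12 * x\<^sup>2 + \<bar>x / 2 * J1\<bar> + \<bar>x * J2\<bar>)"
    unfolding abs_mult[of lam] using gI I_IW b1 b2 unfolding IW
    by (intro add_mono mult_left_mono) linarith+
  also have "\<dots> = e + 7/12 * (R * e) + R\<^sup>2 * x\<^sup>2 / 24 + R * e / 12 * x\<^sup>2 + R * \<bar>x / 2 * J1\<bar> + R * \<bar>x * J2\<bar>"
    by (simp add: algebra_simps power2_eq_square)
  also have "\<dots> \<le> 69 * z * x\<^sup>2 + 7/12 * (69 * z * x\<^sup>2) + 9/4 * z * x\<^sup>2 / 24 + 69 * z * x\<^sup>2 / 12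
      + (3902 * z * x\<^sup>2 * l + 75 * z * x\<^sup>2) + 207 * z * x\<^sup>2"
  proof (intro add_mono e_le J1 J2)
    show "7/12 * (R * e) \<le> 7/12 * (69 * z * x\<^sup>2)" using Re_le by (rule mult_left_mono) simp
    show "R\<^sup>2 * x\<^sup>2 / 24 \<le> 9/4 * z * x\<^sup>2 / 24" using z2 by (intro divide_right_mono mult_right_mono) auto
    have "x\<^sup>2 \<le> 1" using x by (simp add: power_le_one)
    then have "R * e / 12 * x\<^sup>2 \<le> R * e / 12 * 1" using e0 by (intro mult_left_mono) auto
    also have "\<dots> \<le> 69 * z * x\<^sup>2 / 12" using Re_le by (simp add: mult_ac)
    finally show "R * e / 12 * x\<^sup>2 \<le> 69 * z * x\<^sup>2 / 12" .
  qed
  \<comment> \<open>The terms without \<open>l\<close> total less than 400 times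
    \<open>z * x^2\<close>; since \<open>1 \<le> l\<close> they join the logarithmic term from
    \<open>J1\<close> within the constant 5000.\<close>
  also have "\<dots> \<le> 3902 * z * x\<^sup>2 * l + 1000 * (z * x\<^sup>2 * 1)"
    using z0 by (simp add: algebra_simps)
  also have "\<dots> \<le> 3902 * z * x\<^sup>2 * l + 1000 * (z * x\<^sup>2 * l)"
    using l z0 by (intro add_left_mono mult_left_mono) auto
  also have "\<dots> \<le> 5000 * z * x\<^sup>2 * l" using l z0 by simp
  finally show ?thesis unfolding T_def z_def l_def by simp
qed

end

subsection \<open>From eigenfunctions of K to the locale\<close>

lemma K_measurable: "K x \<in> borel_measurable borel"
  unfolding K_def[abs_def] frac_def by measurable

lemma abs_K_le: "\<bar>K x y\<bar> \<le> 1/2"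
  using abs_saw_le[of "1 / (x * y)"] by (auto simp: K_def saw_def)

lemma K_inverse_eq_saw:
  assumes "0 < v" "0 < w" shows "K (1 / v) (1 / w) = saw (v * w)"
  using assms by (simp add: K_def saw_def)

context
  fixes \<phi> :: "real \<Rightarrow> real" and lam :: real
  assumes eig: "eigenfunction \<phi> lam" and unit: "inner01 \<phi> \<phi> = 1"
begin

lemma phi_eq: "x \<in> {0..1} \<Longrightarrow> \<phi> x = lam * (LINT y:{0..1}|lebesgue. K x y * \<phi> y)"
  using eig by (simp add: eigenfunction_def)

lemma phi_measurable: "set_borel_measurable lebesgue {0..1} \<phi>"
  using eig by (simp add: eigenfunction_def L2_01_def)

lemma phi_square_integrable: "set_integrable lebesgue {0..1} (\<lambda>x. (\<phi> x)\<^sup>2)"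
  using eig by (simp add: eigenfunction_def L2_01_def)

lemma phi_square_integral: "(LINT x:{0..1}|lebesgue. (\<phi> x)\<^sup>2) = 1"
  using unit by (simp add: inner01_def power2_eq_square)

lemma const_integrable: "set_integrable lebesgue {0..1::real} (\<lambda>x. c :: real)"
  by (simp add: set_integrable_def)

text \<open>Replaces the Cauchy-Schwarz inequality: for a unit vector the right-hand side has
  integral 1 over the unit interval.\<close>

lemma abs_phi_le_square: "\<bar>\<phi> x\<bar> \<le> (1 + (\<phi> x)\<^sup>2) / 2"
  using zero_le_power2[of "\<bar>\<phi> x\<bar> - 1"] by (simp add: power2_eq_square algebra_simps)

lemma majorant_integrable: "set_integrable lebesgue {0..1} (\<lambda>x. (1 + (\<phi> x)\<^sup>2) / 2)"
  by (intro set_integrable_divide set_integral_add const_integrable phi_square_integrable)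

lemma phi_integrable: "set_integrable lebesgue {0..1} \<phi>"
  by (rule set_integrable_bound[OF majorant_integrable phi_measurable])
     (use abs_phi_le_square in \<open>auto intro!: AE_I2 simp: order.trans[OF abs_phi_le_square]\<close>)

lemma K_phi_integrable: "set_integrable lebesgue {0..1} (\<lambda>y. K x y * \<phi> y)"
proof (rule set_integrable_bound[OF phi_integrable])
  have "K x \<in> borel_measurable lebesgue" by (intro measurable_completion) (simp add: K_measurable)
  with phi_measurable have "(\<lambda>y. K x y * (indicat_real {0..1} y *\<^sub>R \<phi> y)) \<in> borel_measurable lebesgue"
    unfolding set_borel_measurable_def by (intro borel_measurable_times) auto
  then show "set_borel_measurable lebesgue {0..1} (\<lambda>y. K x y * \<phi> y)"
    unfolding set_borel_measurable_def by (simp add: mult_ac)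
  show "AE y in lebesgue. y \<in> {0..1} \<longrightarrow> norm (K x y * \<phi> y) \<le> norm (\<phi> y)"
  proof (intro AE_I2 impI)
    fix y
    have "\<bar>K x y\<bar> * \<bar>\<phi> y\<bar> \<le> 1 * \<bar>\<phi> y\<bar>" using abs_K_le[of x y] by (intro mult_right_mono) auto
    then show "norm (K x y * \<phi> y) \<le> norm (\<phi> y)" by (simp add: abs_mult)
  qed
qed

lemma abs_phi_le:
  assumes "x \<in> {0..1}"
  shows "\<bar>\<phi> x\<bar> \<le> \<bar>lam\<bar> / 2"
proof -
  have "\<bar>LINT y:{0..1}|lebesgue. K x y * \<phi> y\<bar> \<le> (LINT y:{0..1}|lebesgue. \<bar>K x y * \<phi> y\<bar>)"
    using set_integral_norm_bound[OF K_phi_integrable] by simp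
  also have "\<dots> \<le> (LINT y:{0..1}|lebesgue. 1/2 * ((1 + (\<phi> y)\<^sup>2) / 2))"
  proof (rule set_integral_mono)
    show "set_integrable lebesgue {0..1} (\<lambda>y. \<bar>K x y * \<phi> y\<bar>)" by (rule set_integrable_abs[OF K_phi_integrable])
    show "set_integrable lebesgue {0..1} (\<lambda>y. 1/2 * ((1 + (\<phi> y)\<^sup>2) / 2))"
      by (intro set_integrable_mult_right majorant_integrable)
    show "\<bar>K x y * \<phi> y\<bar> \<le> 1/2 * ((1 + (\<phi> y)\<^sup>2) / 2)" for y
      unfolding abs_mult by (intro mult_mono abs_K_le abs_phi_le_square) auto
  qed
  also have "\<dots> = 1/4 * (LINT y:{0..1}|lebesgue. (1::real) + (\<phi> y)\<^sup>2)"
    by (subst set_integral_mult_right[symmetric]) simp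
  also have "\<dots> = 1/4 * ((LINT y:{0..1::real}|lebesgue. 1::real) + (LINT y:{0..1}|lebesgue. (\<phi> y)\<^sup>2))"
    by (subst set_integral_add(2)[OF const_integrable phi_square_integrable]) simp
  also have "(LINT y:{0..1::real}|lebesgue. 1::real) = 1"
    by (simp add: set_lebesgue_integral_def)
  finally have "\<bar>LINT y:{0..1}|lebesgue. K x y * \<phi> y\<bar> \<le> 1/2"
    by (simp add: phi_square_integral)
  then show ?thesis
    using phi_eq[OF assms] mult_left_mono[of "\<bar>LINT y:{0..1}|lebesgue. K x y * \<phi> y\<bar>" "1/2" "\<bar>lam\<bar>"]
    by (simp add: abs_mult)
qed

text \<open>The pointwise bound \<open>\<bar>lam\<bar> / 2\<close> squared and integrated must be at
  least the squared norm 1.\<close>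

lemma abs_lam_ge: "2 \<le> \<bar>lam\<bar>"
proof -
  have "1 = (LINT x:{0..1}|lebesgue. (\<phi> x)\<^sup>2)" by (simp add: phi_square_integral)
  also have "\<dots> \<le> (LINT x:{0..1::real}|lebesgue. (\<bar>lam\<bar> / 2)\<^sup>2)"
  proof (rule set_integral_mono[OF phi_square_integrable const_integrable])
    fix x :: real assume "x \<in> {0..1}"
    then show "(\<phi> x)\<^sup>2 \<le> (\<bar>lam\<bar> / 2)\<^sup>2" using abs_phi_le[of x] by (intro abs_le_square_iff[THEN iffD1]) auto
  qed
  also have "\<dots> = (\<bar>lam\<bar> / 2)\<^sup>2" by (simp add: set_lebesgue_integral_def)
  finally have "1\<^sup>2 \<le> (\<bar>lam\<bar> / 2)\<^sup>2" by simp
  then have "1 \<le> \<bar>lam\<bar> / 2" by (rule power2_le_imp_le) simp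
  then show ?thesis by simp
qed

text \<open>Dominated convergence in the eigenvalue equation: for fixed positive \<open>a\<close>,
  \<open>K\<close> is continuous in its first argument at \<open>a\<close> for all but countably
  many \<open>y\<close>.\<close>

lemma continuous_on_phi: "continuous_on {0<..1} \<phi>"
  unfolding continuous_on_sequentially
proof (intro allI ballI impI)
  fix X :: "nat \<Rightarrow> real" and a assume a: "a \<in> {0<..1}" and X: "(\<forall>n. X n \<in> {0<..1}) \<and> X \<longlonglongrightarrow> a"
  \<comment> \<open>The points \<open>y\<close> at which \<open>1 / (a * y)\<close> is an integer.
    The value \<open>k = 0\<close> gives \<open>1 / 0 = 0\<close>, already listed.\<close>
  define Z where "Z = insert 0 ((\<lambda>k::int. 1 / (a * of_int k)) ` UNIV)"
  have "Z \<in> null_sets lebesgue"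
    unfolding Z_def by (intro null_sets_completionI countable_imp_null_set_lborel) auto
  then have AE: "AE y in lebesgue. y \<notin> Z" by (rule AE_not_in)
  have lim: "(\<lambda>n. K (X n) y) \<longlonglongrightarrow> K a y" if y: "y \<notin> Z" for y
  proof -
    have y0: "y \<noteq> 0" using y by (auto simp: Z_def)
    have "1 / (a * y) \<notin> \<int>"
    proof
      assume "1 / (a * y) \<in> \<int>"
      then obtain k :: int where k: "1 / (a * y) = of_int k" by (auto elim: Ints_cases)
      moreover have "y = 1 / (a * (1 / (a * y)))" using a y0 by simp
      ultimately have "y = 1 / (a * of_int k)" by simp
      then show False using y by (auto simp: Z_def)
    qed
    then have "isCont frac (1 / (a * y))" by (rule continuous_frac)
    moreover have "(\<lambda>n. 1 / (X n * y)) \<longlonglongrightarrow> 1 / (a * y)"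
      using X a y0 by (intro tendsto_intros) auto
    ultimately have "(\<lambda>n. frac (1 / (X n * y))) \<longlonglongrightarrow> frac (1 / (a * y))"
      by (rule isCont_tendsto_compose)
    then have "(\<lambda>n. 1/2 - frac (1 / (X n * y))) \<longlonglongrightarrow> 1/2 - frac (1 / (a * y))"
      by (intro tendsto_intros)
    moreover have "X n * y \<noteq> 0" for n using X y0 by (metis greaterThanAtMost_iff less_irrefl mult_eq_0_iff)
    moreover have "a * y \<noteq> 0" using a y0 by auto
    ultimately show ?thesis by (simp add: K_def)
  qed
  have "(\<lambda>n. LINT y|lebesgue. indicat_real {0..1} y *\<^sub>R (K (X n) y * \<phi> y))
      \<longlonglongrightarrow> (LINT y|lebesgue. indicat_real {0..1} y *\<^sub>R (K a y * \<phi> y))"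
  proof (rule integral_dominated_convergence[where w = "\<lambda>y. indicat_real {0..1} y *\<^sub>R \<bar>\<phi> y\<bar>"])
    show "(\<lambda>y. indicat_real {0..1} y *\<^sub>R (K a y * \<phi> y)) \<in> borel_measurable lebesgue"
      using K_phi_integrable unfolding set_integrable_def by (rule borel_measurable_integrable)
    show "(\<lambda>y. indicat_real {0..1} y *\<^sub>R (K (X n) y * \<phi> y)) \<in> borel_measurable lebesgue" for n
      using K_phi_integrable unfolding set_integrable_def by (rule borel_measurable_integrable)
    show "integrable lebesgue (\<lambda>y. indicat_real {0..1} y *\<^sub>R \<bar>\<phi> y\<bar>)"
      using set_integrable_abs[OF phi_integrable] unfolding set_integrable_def .
    show "AE y in lebesgue. (\<lambda>n. indicat_real {0..1} y *\<^sub>R (K (X n) y * \<phi> y))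
        \<longlonglongrightarrow> indicat_real {0..1} y *\<^sub>R (K a y * \<phi> y)"
      using AE by eventually_elim (intro tendsto_intros lim)
    show "AE y in lebesgue. norm (indicat_real {0..1} y *\<^sub>R (K (X n) y * \<phi> y)) \<le> indicat_real {0..1} y *\<^sub>R \<bar>\<phi> y\<bar>" for n
    proof (intro AE_I2)
      fix y
      have "\<bar>K (X n) y\<bar> * \<bar>\<phi> y\<bar> \<le> 1 * \<bar>\<phi> y\<bar>" using abs_K_le[of "X n" y] by (intro mult_right_mono) auto
      then show "norm (indicat_real {0..1} y *\<^sub>R (K (X n) y * \<phi> y)) \<le> indicat_real {0..1} y *\<^sub>R \<bar>\<phi> y\<bar>"
        by (simp add: abs_mult indicator_def)
    qed
  qed
  then have "(\<lambda>n. lam * (LINT y:{0..1}|lebesgue. K (X n) y * \<phi> y)) \<longlonglongrightarrow> lam * (LINT y:{0..1}|lebesgue. K a y * \<phi> y)"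
    unfolding set_lebesgue_integral_def by (intro tendsto_intros)
  moreover have "X n \<in> {0..1}" for n using X by (metis atLeastAtMost_iff greaterThanAtMost_iff less_imp_le)
  moreover have "a \<in> {0..1}" using a by auto
  ultimately show "(\<phi> \<circ> X) \<longlonglongrightarrow> \<phi> a" by (simp add: phi_eq[symmetric] o_def)
qed

text \<open>The substitution \<open>y = 1 / w\<close> carries the unit interval to
  \<open>{1..}\<close>, with Jacobian \<open>1 / w^2\<close>. The \<open>max\<close> extends the
  function continuously by a constant below 1, since the locale asks for continuity on the whole
  line.\<close>

lemma saw_eigenfunction_inverse: "saw_eigenfunction (\<lambda>v. \<phi> (1 / max 1 v)) lam"
proof
  fix v :: real
  have "continuous_on UNIV (\<lambda>v. \<phi> (1 / max 1 v))"
    by (rule continuous_on_compose2[OF continuous_on_phi]) (auto intro!: continuous_intros)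
  then show "isCont (\<lambda>v. \<phi> (1 / max 1 v)) v" by (simp add: continuous_on_eq_continuous_at)
  show "\<bar>\<phi> (1 / max 1 v)\<bar> \<le> \<bar>lam\<bar> / 2" by (rule abs_phi_le) auto
  show "2 \<le> \<bar>lam\<bar>" by (rule abs_lam_ge)
  assume v: "1 \<le> v"
  let ?f = "\<lambda>y. K (1 / v) y * \<phi> y"
  have img: "(\<lambda>w. 1 / w) ` {1..} = {0<..1::real}"
  proof (intro set_eqI iffI)
    fix y :: real assume "y \<in> {0<..1}"
    then show "y \<in> (\<lambda>w. 1 / w) ` {1..}" by (intro image_eqI[of _ _ "1 / y"]) auto
  qed auto
  have sub: "?f absolutely_integrable_on {0<..1}"
    by (rule set_integrable_subset[OF K_phi_integrable]) auto
  have cov: "(\<lambda>w. \<bar>- (1 / w\<^sup>2)\<bar> * ?f (1 / w)) absolutely_integrable_on {1..} \<and>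
      integral {1..} (\<lambda>w. \<bar>- (1 / w\<^sup>2)\<bar> * ?f (1 / w)) = integral {0<..1} ?f"
  proof (rule has_absolute_integral_change_of_variables_1'[where S = "{1..}" and f = ?f and g = "\<lambda>w. 1 / w"
        and g' = "\<lambda>w. - (1 / w\<^sup>2)" and b = "integral {0<..1} ?f", THEN iffD2])
    show "((\<lambda>w. 1 / w) has_real_derivative - (1 / w\<^sup>2)) (at w within {1..})" if "w \<in> {1..}" for w :: real
      using that by (auto intro!: derivative_eq_intros simp: power2_eq_square)
    show "inj_on (\<lambda>w. 1 / w) {1::real..}" by (auto simp: inj_on_def)
    show "?f absolutely_integrable_on (\<lambda>w. 1 / w) ` {1..} \<and>
      integral ((\<lambda>w. 1 / w) ` {1..}) ?f = integral {0<..1} ?f" unfolding img using sub by simp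
  qed auto
  have eq: "\<bar>- (1 / w\<^sup>2)\<bar> * ?f (1 / w) = saw (v * w) * (\<phi> (1 / max 1 w) / w\<^sup>2)" if "w \<in> {1..}" for w
    using that v by (simp add: K_inverse_eq_saw max_def)
  from conjunct1[OF cov] show "(\<lambda>w. saw (v * w) * (\<phi> (1 / max 1 w) / w\<^sup>2)) absolutely_integrable_on {1..}"
    by (subst set_integrable_cong[OF refl refl eq[symmetric]])
  have "integral {1..} (\<lambda>w. saw (v * w) * (\<phi> (1 / max 1 w) / w\<^sup>2))
      = integral {1..} (\<lambda>w. \<bar>- (1 / w\<^sup>2)\<bar> * ?f (1 / w))"
    by (rule Henstock_Kurzweil_Integration.integral_cong) (rule eq[symmetric])
  also have "\<dots> = integral {0<..1} ?f" by (rule conjunct2[OF cov])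
  \<comment> \<open>The point 0, which the substitution misses, is negligible.\<close>
  also have "integral {0<..1} ?f = integral {0..1} ?f"
    by (rule integral_spike_set) (auto intro: negligible_subset[of "{0}"])
  also have "\<dots> = (LINT y:{0..1}|lebesgue. ?f y)"
    using set_lebesgue_integral_eq_integral(2)[OF K_phi_integrable] by simp
  finally have "integral {1..} (\<lambda>w. saw (v * w) * (\<phi> (1 / max 1 w) / w\<^sup>2)) = (LINT y:{0..1}|lebesgue. ?f y)" .
  then show "\<phi> (1 / max 1 v) = lam * integral {1..} (\<lambda>w. saw (v * w) * (\<phi> (1 / max 1 w) / w\<^sup>2))"
    using phi_eq[of "1 / v"] v by (simp add: max_def)
qed

end

theorem theorem5p11:
  shows "\<exists>C>0. \<forall>phi lam. max_ortho_eigsys phi lam \<longrightarrow>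
    (\<forall>j\<ge>1. \<forall>x\<in>{0<..1}.
       \<bar>phi j x / x - 1/2 * lam j * phi j 1 * B2 (1 / x)\<bar>
         \<le> C * \<bar>lam j\<bar>^5 * (ln \<bar>lam j\<bar>)^2 * x * (1 + ln (1 / x)))"
\<comment> \<open>The constant is that of \<open>g_asymptotics\<close>, which is applied to each
  \<open>phi j\<close> and divided by \<open>x\<close>.\<close>
proof (intro exI[of _ 5000] conjI allI impI ballI)
  fix phi :: "nat \<Rightarrow> real \<Rightarrow> real" and lam :: "nat \<Rightarrow> real" and j :: nat and x :: real
  assume sys: "max_ortho_eigsys phi lam" and j: "1 \<le> j" and "x \<in> {0<..1}"
  then have x: "0 < x" "x \<le> 1" by auto
  have "eigenfunction (phi j) (lam j)" "inner01 (phi j) (phi j) = 1"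
    using sys j by (auto simp: max_ortho_eigsys_def)
  then interpret saw_eigenfunction "\<lambda>v. phi j (1 / max 1 v)" "lam j"
    by (rule saw_eigenfunction_inverse)
  have "\<bar>phi j x - lam j * x / 2 * phi j 1 * B2 (1 / x)\<bar>
      \<le> 5000 * (\<bar>lam j\<bar> ^ 5 * (ln \<bar>lam j\<bar>)\<^sup>2) * x\<^sup>2 * (1 + ln (1 / x))"
    using g_asymptotics[OF x] x by (simp add: max_def)
  then have "\<bar>phi j x - lam j * x / 2 * phi j 1 * B2 (1 / x)\<bar> / x
      \<le> 5000 * (\<bar>lam j\<bar> ^ 5 * (ln \<bar>lam j\<bar>)\<^sup>2) * x\<^sup>2 * (1 + ln (1 / x)) / x"
    using x by (intro divide_right_mono) auto
  moreover have "\<bar>phi j x - lam j * x / 2 * phi j 1 * B2 (1 / x)\<bar> / x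
      = \<bar>phi j x / x - 1/2 * lam j * phi j 1 * B2 (1 / x)\<bar>"
  proof -
    have "(phi j x - lam j * x / 2 * phi j 1 * B2 (1 / x)) / x = phi j x / x - 1/2 * lam j * phi j 1 * B2 (1 / x)"
      using x by (simp add: diff_divide_distrib)
    then show ?thesis using x by (metis abs_divide abs_of_pos)
  qed
  moreover have "5000 * (\<bar>lam j\<bar> ^ 5 * (ln \<bar>lam j\<bar>)\<^sup>2) * x\<^sup>2 * (1 + ln (1 / x)) / x
      = 5000 * \<bar>lam j\<bar>^5 * (ln \<bar>lam j\<bar>)^2 * x * (1 + ln (1 / x))"
    using x by (simp add: power2_eq_square)
  ultimately show "\<bar>phi j x / x - 1/2 * lam j * phi j 1 * B2 (1 / x)\<bar>
      \<le> 5000 * \<bar>lam j\<bar>^5 * (ln \<bar>lam j\<bar>)^2 * x * (1 + ln (1 / x))" by simp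
qed simp

end
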